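(* Let $\sigma$ be a primitive substitution on a finite alphabet $A$, let $X$ be its shift space, and let $\varphi\colon A^*\to G$ be a (monoid) morphism onto a finite group $G$. If $\sigma$ is invertible under $\varphi$, then the minimal closed invariant subsets of $G\rtimes_\varphi X$ are uniquely ergodic.
   Context: A substitution is a monoid endomorphism $\sigma\colon A^*\to A^*$; it is primitive if there is $n\ge1$ such that for all $a,b\in A$ the letter $b$ occurs in $\sigma^n(a)$. Its shift space $X=X(\sigma)$ is the set of $x\in A^{\mathbb Z}$ all of whose finite factors occur in some $\sigma^n(a)$, $n\ge0$, $a\in A$ (shift spaces are assumed nonempty), with the shift map $S((x_n)_n)=(x_{n+1})_n$. The substitution $\sigma$ is invertible under $\varphi$ if there exists $n\ge1$ with $\varphi\circ\sigma^n=\varphi$. The skew product $G\rtimes_\varphi X$ is the dynamical system $(G\times X,T_\varphi)$, $G$ discrete, with $T_\varphi(g,x)=(g\varphi(x_0),Sx)$. A minimal closed invariant subset $Y$ is a nonempty closed $T_\varphi$-invariant subset with no proper nonempty closed $T_\varphi$-invariant subset; it is uniquely ergodic if there is exactly one $T_\varphi$-invariant Borel probability measure on $Y$. *)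

theory Defs
  imports "HOL-Probability.Probability_Measure" "HOL-Algebra.Group" "HOL-Library.Sublist"
begin

definition free_monoid :: "'a list monoid" where
  "free_monoid = \<lparr>carrier = UNIV, mult = (@), one = []\<rparr>"

text \<open>In contrast to \<^const>\<open>hom\<close>, preservation of the unit is required explicitly.\<close>

definition monoid_morphism ::
  "('m, 'k) monoid_scheme \<Rightarrow> ('n, 'l) monoid_scheme \<Rightarrow> ('m \<Rightarrow> 'n) \<Rightarrow> bool" where
  "monoid_morphism M N h \<longleftrightarrow> h \<in> hom M N \<and> h \<one>\<^bsub>M\<^esub> = \<one>\<^bsub>N\<^esub>"

definition substitution :: "('a list \<Rightarrow> 'a list) \<Rightarrow> bool" where
  "substitution \<sigma> \<longleftrightarrow> monoid_morphism free_monoid free_monoid \<sigma>"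

definition primitive :: "('a list \<Rightarrow> 'a list) \<Rightarrow> bool" where
  "primitive \<sigma> \<longleftrightarrow> (\<exists>n\<ge>1. \<forall>a b. b \<in> set ((\<sigma> ^^ n) [a]))"

definition shift_space :: "('a list \<Rightarrow> 'a list) \<Rightarrow> (int \<Rightarrow> 'a) set" where
  "shift_space \<sigma> = {x. \<forall>i j. \<exists>n a. sublist (map x [i..j]) ((\<sigma> ^^ n) [a])}"

definition shift_map :: "(int \<Rightarrow> 'a) \<Rightarrow> (int \<Rightarrow> 'a)" where
  "shift_map x = (\<lambda>n. x (n + 1))"

definition full_shift_topology :: "(int \<Rightarrow> 'a) topology" where
  "full_shift_topology = product_topology (\<lambda>_. discrete_topology UNIV) UNIV"

definition invertible_under :: "('a list \<Rightarrow> 'g) \<Rightarrow> ('a list \<Rightarrow> 'a list) \<Rightarrow> bool" where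
  "invertible_under \<phi> \<sigma> \<longleftrightarrow> (\<exists>n\<ge>1. \<phi> \<circ> (\<sigma> ^^ n) = \<phi>)"

definition skew_topology ::
  "('g, 'k) monoid_scheme \<Rightarrow> (int \<Rightarrow> 'a) set \<Rightarrow> ('g \<times> (int \<Rightarrow> 'a)) topology" where
  "skew_topology G X =
     prod_topology (discrete_topology (carrier G)) (subtopology full_shift_topology X)"

definition skew_map ::
  "('g, 'k) monoid_scheme \<Rightarrow> ('a list \<Rightarrow> 'g) \<Rightarrow> 'g \<times> (int \<Rightarrow> 'a) \<Rightarrow> 'g \<times> (int \<Rightarrow> 'a)" where
  "skew_map G \<phi> = (\<lambda>(g, x). (g \<otimes>\<^bsub>G\<^esub> \<phi> [x 0], shift_map x))"

definition closed_invariant :: "'x topology \<Rightarrow> ('x \<Rightarrow> 'x) \<Rightarrow> 'x set \<Rightarrow> bool" where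
  "closed_invariant \<T> T Y \<longleftrightarrow> closedin \<T> Y \<and> T ` Y \<subseteq> Y"

definition minimal_closed_invariant :: "'x topology \<Rightarrow> ('x \<Rightarrow> 'x) \<Rightarrow> 'x set \<Rightarrow> bool" where
  "minimal_closed_invariant \<T> T Y \<longleftrightarrow>
     closed_invariant \<T> T Y \<and> Y \<noteq> {} \<and>
     \<not> (\<exists>Z. closed_invariant \<T> T Z \<and> Z \<noteq> {} \<and> Z \<subset> Y)"

definition borel_measurable_space :: "'x topology \<Rightarrow> 'x measure" where
  "borel_measurable_space \<T> = sigma (topspace \<T>) {U. openin \<T> U}"

definition invariant_borel_probability ::
  "'x topology \<Rightarrow> ('x \<Rightarrow> 'x) \<Rightarrow> 'x measure \<Rightarrow> bool" where
  "invariant_borel_probability \<T> T \<mu> \<longleftrightarrow>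
     sets \<mu> = sets (borel_measurable_space \<T>) \<and> prob_space \<mu> \<and>
     (\<forall>B\<in>sets \<mu>. emeasure \<mu> (T -` B \<inter> space \<mu>) = emeasure \<mu> B)"

text \<open>Equality of measures in HOL compares space, measurable sets and values (which are zero off
  the measurable sets), so the unique existence below is the usual one.\<close>

definition uniquely_ergodic :: "'x topology \<Rightarrow> ('x \<Rightarrow> 'x) \<Rightarrow> 'x set \<Rightarrow> bool" where
  "uniquely_ergodic \<T> T Y \<longleftrightarrow> (\<exists>!\<mu>. invariant_borel_probability (subtopology \<T> Y) T \<mu>)"

end

theory Submission
  imports Defs "HOL-Algebra.Multiplicative_Group"
begin

text \<open>
  Some power \<open>\<tau>\<close> of the substitution maps each letter to a word containing all letters and
  satisfies \<open>\<phi> \<circ> \<tau> = \<phi>\<close>, so \<open>\<tau>\<close> lifts to a substitution on the alphabet \<open>G \<times> A\<close>: the letter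
  \<open>(g, a)\<close> is replaced by the states met while reading \<open>\<tau> a\<close> starting from \<open>g\<close>. After a further
  power, the relation \<open>t\<close> \<^emph>\<open>occurs in the image of\<close> \<open>s\<close> on \<open>G \<times> A\<close> is idempotent, and because \<open>G\<close>
  is finite and acts by left translations it is then an equivalence relation. On each of its
  classes the lifted substitution maps every letter to a word containing the whole class, so words
  have uniform frequencies in its language. The class of the state at the origin is a
  locally constant invariant function on \<open>G \<times> X\<close>, so it is constant on a minimal set: all
  itineraries there lie in the language of one class, and the Birkhoff averages of every cylinder
  converge everywhere to a constant. This limit determines the invariant measures by dominated
  convergence, and defines one by compactness.
\<close>

section \<open>Words and substitutions\<close>

lemma substitutionI: "(\<And>u v. \<theta> (u @ v) = \<theta> u @ \<theta> v) \<Longrightarrow> \<theta> [] = [] \<Longrightarrow> substitution \<theta>"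
  by (simp add: substitution_def monoid_morphism_def free_monoid_def hom_def)

lemma substitution_append: "substitution \<theta> \<Longrightarrow> \<theta> (u @ v) = \<theta> u @ \<theta> v"
  by (simp add: substitution_def monoid_morphism_def free_monoid_def hom_def)

lemma substitution_Nil: "substitution \<theta> \<Longrightarrow> \<theta> [] = []"
  by (simp add: substitution_def monoid_morphism_def free_monoid_def)

lemma substitution_funpow:
  assumes "substitution \<theta>"
  shows "substitution (\<theta> ^^ n)"
proof (induction n)
  case (Suc n)
  then show ?case
    using assms by (intro substitutionI) (simp_all add: substitution_append substitution_Nil)
qed (simp add: substitutionI)

lemma substitution_eq_concat:
  assumes "substitution \<theta>"
  shows "\<theta> u = concat (map (\<lambda>a. \<theta> [a]) u)"
proof (induction u)
  case (Cons a u)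
  then show ?case using substitution_append[OF assms, of "[a]" u] by simp
qed (simp add: substitution_Nil[OF assms])

lemma set_substitution:
  assumes "substitution \<theta>"
  shows "set (\<theta> u) = (\<Union>a\<in>set u. set (\<theta> [a]))"
  by (subst substitution_eq_concat[OF assms]) simp

lemma sublist_substitution:
  assumes "substitution \<theta>" "sublist u v"
  shows "sublist (\<theta> u) (\<theta> v)"
proof -
  obtain s t where "v = s @ u @ t" using assms(2) by (auto simp: sublist_def)
  then show ?thesis by (simp add: substitution_append[OF assms(1)])
qed

lemma sublist_substitution_letter:
  assumes "substitution \<theta>" "a \<in> set u"
  shows "sublist (\<theta> [a]) (\<theta> u)"
proof (rule sublist_substitution[OF assms(1)])
  obtain v w where "u = v @ [a] @ w" using split_list[OF assms(2)] by auto
  then show "sublist [a] u" by (simp only: sublist_appendI)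
qed

lemma prefix_concatD:
  assumes "prefix w (concat bs)" "\<And>b. b \<in> set bs \<Longrightarrow> length b \<le> K"
  shows "\<exists>cs p. w = concat cs @ p \<and> set cs \<subseteq> set bs \<and> length p \<le> K"
  using assms
proof (induction bs arbitrary: w)
  case (Cons b bs)
  consider "prefix w b" | u where "w = b @ u" "prefix u (concat bs)"
    using Cons.prems(1) by (auto simp: prefix_append)
  then show ?case
  proof cases
    case 1
    then have "length w \<le> K" using Cons.prems(2)[of b] prefix_length_le by fastforce
    then show ?thesis by (intro exI[of _ "[]"] exI[of _ w]) simp
  next
    case 2
    then obtain cs p where "u = concat cs @ p" "set cs \<subseteq> set bs" "length p \<le> K"
      using Cons.IH[of u] Cons.prems(2) by auto
    then show ?thesis using 2(1) by (intro exI[of _ "b # cs"] exI[of _ p]) auto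
  qed
qed simp

lemma sublist_concatD:
  assumes "sublist w (concat bs)" "\<And>b. b \<in> set bs \<Longrightarrow> length b \<le> K"
  shows "\<exists>s cs p. w = s @ concat cs @ p \<and> set cs \<subseteq> set bs \<and> length s \<le> K \<and> length p \<le> K"
  using assms
proof (induction bs)
  case (Cons b bs)
  consider "sublist w b" | "sublist w (concat bs)"
    | s u where "w = s @ u" "suffix s b" "prefix u (concat bs)"
    using Cons.prems(1) by (auto simp: sublist_append)
  then show ?case
  proof cases
    case 1
    then have "length w \<le> K" using Cons.prems(2)[of b] sublist_length_le by fastforce
    then show ?thesis by (intro exI[of _ w] exI[of _ "[]"]) simp
  next
    case 2
    then obtain s cs p where "w = s @ concat cs @ p" "set cs \<subseteq> set bs" "length s \<le> K" "length p \<le> K"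
      using Cons.IH Cons.prems(2) by auto
    then show ?thesis by (intro exI[of _ s] exI[of _ cs] exI[of _ p]) auto
  next
    case 3
    obtain cs p where "u = concat cs @ p" "set cs \<subseteq> set bs" "length p \<le> K"
      using prefix_concatD[OF 3(3), of K] Cons.prems(2) by auto
    moreover have "length s \<le> K" using 3(2) Cons.prems(2)[of b] suffix_length_le by fastforce
    ultimately show ?thesis using 3(1) by (intro exI[of _ s] exI[of _ cs] exI[of _ p]) auto
  qed
qed simp

section \<open>Quasi-additive functions of words\<close>

definition quasi_additive :: "real \<Rightarrow> ('b list \<Rightarrow> real) \<Rightarrow> bool" where
  "quasi_additive K f \<longleftrightarrow> (\<forall>u v. \<bar>f (u @ v) - f u - f v\<bar> \<le> K)"

lemma quasi_additiveD: "quasi_additive K f \<Longrightarrow> \<bar>f (u @ v) - f u - f v\<bar> \<le> K"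
  by (simp add: quasi_additive_def)

lemma quasi_additive_nonneg: "quasi_additive K f \<Longrightarrow> 0 \<le> K"
  using quasi_additiveD[of K f "[]" "[]"] by linarith

lemma quasi_additive_uminus:
  assumes "quasi_additive K f"
  shows "quasi_additive K (\<lambda>w. - f w)"
  unfolding quasi_additive_def
proof (intro allI)
  show "\<bar>- f (u @ v) - - f u - - f v\<bar> \<le> K" for u v
    using quasi_additiveD[OF assms, of u v] by linarith
qed

lemma quasi_additive_diff_length:
  fixes f :: "'b list \<Rightarrow> real"
  assumes "quasi_additive K f"
  shows "quasi_additive K (\<lambda>w. f w - c * real (length w))"
  unfolding quasi_additive_def
proof (intro allI)
  fix u v :: "'b list"
  have "c * real (length (u @ v)) = c * real (length u) + c * real (length v)"
    by (simp add: distrib_left)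
  then show "\<bar>f (u @ v) - c * real (length (u @ v)) - (f u - c * real (length u)) -
      (f v - c * real (length v))\<bar> \<le> K"
    using quasi_additiveD[OF assms, of u v] by linarith
qed

lemma quasi_additive_concat:
  assumes "quasi_additive K f"
  shows "\<bar>f (concat bs) - (\<Sum>b\<leftarrow>bs. f b)\<bar> \<le> K * (1 + length bs)"
proof (induction bs)
  case Nil
  then show ?case using quasi_additiveD[OF assms, of "[]" "[]"] by simp
next
  case (Cons b bs)
  then show ?case using quasi_additiveD[OF assms, of b "concat bs"] by (simp add: algebra_simps)
qed

lemma quasi_additive_concat_le_member:
  assumes "quasi_additive K f" and nonpos: "\<And>b. b \<in> set bs \<Longrightarrow> f b \<le> 0" and "b \<in> set bs"
  shows "f (concat bs) \<le> f b + K * (1 + length bs)"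
proof -
  obtain us vs where bs: "bs = us @ b # vs" using split_list[OF assms(3)] by blast
  have "(\<Sum>b\<leftarrow>us. f b) \<le> 0" "(\<Sum>b\<leftarrow>vs. f b) \<le> 0"
    by (rule sum_list_nonpos; use nonpos bs in auto)+
  then have "(\<Sum>b\<leftarrow>bs. f b) \<le> f b" by (simp add: bs)
  then show ?thesis using quasi_additive_concat[OF assms(1), of bs] by linarith
qed

lemma quasi_additive_concat_small:
  fixes e :: real
  assumes "quasi_additive K f" and "\<And>b. b \<in> set bs \<Longrightarrow> \<bar>f b\<bar> + K \<le> e * length b"
  shows "\<bar>f (concat bs)\<bar> \<le> e * length (concat bs) + K"
  using assms(2)
proof (induction bs)
  case Nil
  then show ?case using quasi_additiveD[OF assms(1), of "[]" "[]"] by simp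
next
  case (Cons b bs)
  have "\<bar>f (concat bs)\<bar> \<le> e * length (concat bs) + K"
    by (rule Cons.IH, rule Cons.prems) simp
  moreover have "\<bar>f b\<bar> + K \<le> e * length b" by (rule Cons.prems) simp
  moreover have "\<bar>f (b @ concat bs) - f b - f (concat bs)\<bar> \<le> K" by (rule quasi_additiveD) fact
  ultimately show ?case unfolding concat.simps length_append of_nat_add distrib_left by linarith
qed

text \<open>Truncating the blocks at the end of the word makes \<open>block_sum\<close> only quasi-additive.\<close>

definition block_sum :: "nat \<Rightarrow> ('b list \<Rightarrow> real) \<Rightarrow> 'b list \<Rightarrow> real" where
  "block_sum L F w = (\<Sum>i<length w. F (take L (drop i w)))"

lemma sum_diff_le_tail:
  fixes f g :: "nat \<Rightarrow> real"
  assumes f: "\<And>i. \<bar>f i\<bar> \<le> 1" and g: "\<And>i. \<bar>g i\<bar> \<le> 1"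
    and eq: "\<And>i. i + L \<le> N \<Longrightarrow> f i = g i"
  shows "\<bar>(\<Sum>i<N. f i) - (\<Sum>i<N. g i)\<bar> \<le> 2 * L"
proof -
  have "\<bar>(\<Sum>i<N. f i) - (\<Sum>i<N. g i)\<bar> \<le> (\<Sum>i<N. \<bar>f i - g i\<bar>)"
    by (simp flip: sum_subtractf)
  also have "\<dots> = (\<Sum>i\<in>{N - L..<N}. \<bar>f i - g i\<bar>)"
    by (rule sum.mono_neutral_right) (auto simp: eq)
  also have "\<dots> \<le> (\<Sum>i\<in>{N - L..<N}. 2)"
  proof (rule sum_mono)
    show "\<bar>f i - g i\<bar> \<le> 2" for i using f[of i] g[of i] by linarith
  qed
  also have "\<dots> \<le> 2 * L" by simp
  finally show ?thesis .
qed

lemma quasi_additive_block_sum: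
  fixes F :: "'b list \<Rightarrow> real"
  assumes "\<And>w. \<bar>F w\<bar> \<le> 1"
  shows "quasi_additive (2 * real L) (block_sum L F)"
  unfolding quasi_additive_def
proof (intro allI)
  fix u v :: "'b list"
  have "(\<Sum>i\<in>{length u..<length u + length v}. F (take L (drop i (u @ v)))) = block_sum L F v"
    using sum.shift_bounds_nat_ivl[of "\<lambda>i. F (take L (drop i (u @ v)))" 0 "length u" "length v"]
    by (simp add: block_sum_def lessThan_atLeast0 add.commute)
  then have "block_sum L F (u @ v) = (\<Sum>i<length u. F (take L (drop i (u @ v)))) + block_sum L F v"
    unfolding block_sum_def lessThan_atLeast0 length_append
    by (simp flip: sum.atLeastLessThan_concat[of 0 "length u" "length u + length v"])
  moreover have "\<bar>(\<Sum>i<length u. F (take L (drop i (u @ v)))) - block_sum L F u\<bar> \<le> 2 * L"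
    unfolding block_sum_def by (rule sum_diff_le_tail) (use assms in auto)
  ultimately show "\<bar>block_sum L F (u @ v) - block_sum L F u - block_sum L F v\<bar> \<le> 2 * real L"
    by simp
qed

definition long_words :: "'b list set \<Rightarrow> 'b list filter" where
  "long_words W = inf (filtercomap length at_top) (principal W)"

lemma eventually_long_words:
  "eventually P (long_words W) \<longleftrightarrow> (\<exists>N. \<forall>w\<in>W. N \<le> length w \<longrightarrow> P w)"
  unfolding long_words_def eventually_inf_principal eventually_filtercomap_at_top_linorder by blast

lemma filterlim_long_words:
  assumes "\<And>n. w n \<in> W" "\<And>n. length (w n) = n"
  shows "filterlim w (long_words W) sequentially"
  unfolding long_words_def filterlim_inf filterlim_principal filterlim_filtercomap_iff
  using assms by (simp add: comp_def filterlim_ident)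

section \<open>Contraction of oscillations\<close>

text \<open>The gap \<open>U n - l n\<close> shrinks by a fixed proportion at each step up to summable errors,
  so it is summable, and it bounds the variation of \<open>U\<close>.\<close>

lemma bounds_converge_together:
  fixes U l e :: "nat \<Rightarrow> real"
  assumes "d > 0" and "summable e" and e: "\<And>n. 0 \<le> e n" and lU: "\<And>n. l n \<le> U n"
    and U_step: "\<And>n. U (Suc n) \<le> U n - d * (U n - l n) + e n"
    and l_step: "\<And>n. l n - e n \<le> l (Suc n)"
  shows "\<exists>c. U \<longlonglongrightarrow> c \<and> l \<longlonglongrightarrow> c"
proof -
  have partial: "d * (\<Sum>k<n. U k - l k) + (U n - l n) \<le> U 0 - l 0 + 2 * (\<Sum>k<n. e k)" for n
  proof (induction n)
    case (Suc n)
    show ?case using Suc U_step[of n] l_step[of n] by (simp add: distrib_left)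
  qed simp
  have gap: "summable (\<lambda>n. U n - l n)"
  proof (rule summableI_nonneg_bounded)
    show "0 \<le> U n - l n" for n using lU by simp
    show "(\<Sum>k<n. U k - l k) \<le> (U 0 - l 0 + 2 * suminf e) / d" for n
    proof -
      have "(\<Sum>k<n. e k) \<le> suminf e" using \<open>summable e\<close> e by (intro sum_le_suminf) auto
      then have "d * (\<Sum>k<n. U k - l k) \<le> U 0 - l 0 + 2 * suminf e"
        using partial[of n] lU[of n] by linarith
      then show ?thesis using \<open>d > 0\<close> by (simp add: field_simps)
    qed
  qed
  have "summable (\<lambda>n. U (Suc n) - U n)"
  proof (rule summable_comparison_test'[where N = 0])
    show "summable (\<lambda>n. (U n - l n) + e n)" using gap \<open>summable e\<close> by (rule summable_add)
    fix n
    have "d * (U n - l n) \<ge> 0" using \<open>d > 0\<close> lU by simp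
    then show "norm (U (Suc n) - U n) \<le> (U n - l n) + e n"
      using U_step[of n] l_step[of n] lU[of "Suc n"] lU[of n] by (simp add: abs_le_iff)
  qed
  then have "convergent (\<lambda>n. \<Sum>k<n. U (Suc k) - U k)"
    by (simp only: summable_iff_convergent)
  then have "convergent (\<lambda>n. U n - U 0)" by (simp only: sum_lessThan_telescope)
  then obtain c where "(\<lambda>n. U n - U 0) \<longlonglongrightarrow> c" by (auto simp: convergent_def)
  from tendsto_add[OF this tendsto_const[of "U 0"]] have U: "U \<longlonglongrightarrow> c + U 0" by simp
  moreover from tendsto_diff[OF U summable_LIMSEQ_zero[OF gap]] have "l \<longlonglongrightarrow> c + U 0" by simp
  ultimately show ?thesis by blast
qed

lemma oscillation_contraction:
  fixes r :: "nat \<Rightarrow> 's \<Rightarrow> real" and e :: "nat \<Rightarrow> real" and d :: real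
  assumes "finite C" "C \<noteq> {}" and "d > 0" "summable e" "\<And>n. 0 \<le> e n"
    and upper: "\<And>n s t m. s \<in> C \<Longrightarrow> t \<in> C \<Longrightarrow> (\<And>u. u \<in> C \<Longrightarrow> r n u \<le> m) \<Longrightarrow>
      r (Suc n) s \<le> m - d * (m - r n t) + e n"
    and lower: "\<And>n s m. s \<in> C \<Longrightarrow> (\<And>u. u \<in> C \<Longrightarrow> m \<le> r n u) \<Longrightarrow> m - e n \<le> r (Suc n) s"
  shows "\<exists>c. \<forall>s\<in>C. (\<lambda>n. r n s) \<longlonglongrightarrow> c"
proof -
  define U where "U n = Max (r n ` C)" for n
  define l where "l n = Min (r n ` C)" for n
  have U: "r n s \<le> U n" and l: "l n \<le> r n s" if "s \<in> C" for n s
    unfolding U_def l_def using that assms(1) by auto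
  have "U n \<in> r n ` C" "l n \<in> r n ` C" for n
    unfolding U_def l_def by (rule Max_in Min_in; use assms(1,2) in simp)+
  then have U_attained: "\<exists>s\<in>C. U n = r n s" and l_attained: "\<exists>s\<in>C. l n = r n s" for n
    by blast+
  have "\<exists>c. U \<longlonglongrightarrow> c \<and> l \<longlonglongrightarrow> c"
  proof (rule bounds_converge_together[OF assms(3,4,5)])
    fix n
    obtain s t where s: "s \<in> C" "U (Suc n) = r (Suc n) s" and t: "t \<in> C" "l n = r n t"
      using U_attained[of "Suc n"] l_attained[of n] by blast
    show "l n \<le> U n" using l[OF t(1)] U[OF t(1)] by (rule order_trans)
    show "U (Suc n) \<le> U n - d * (U n - l n) + e n"
      unfolding s(2) t(2) using s(1) t(1) U by (rule upper)
    obtain s' where s': "s' \<in> C" "l (Suc n) = r (Suc n) s'"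
      using l_attained[of "Suc n"] by blast
    show "l n - e n \<le> l (Suc n)"
      unfolding s'(2) using s'(1) l by (rule lower)
  qed
  then obtain c where c: "U \<longlonglongrightarrow> c" "l \<longlonglongrightarrow> c" by blast
  have "(\<lambda>n. r n s) \<longlonglongrightarrow> c" if "s \<in> C" for s
    by (rule tendsto_sandwich[OF _ _ c(2,1)]) (use U l that in \<open>auto intro!: always_eventually\<close>)
  then show ?thesis by blast
qed

section \<open>Uniform frequencies for positive substitutions\<close>

locale positive_substitution =
  fixes \<theta> :: "'b list \<Rightarrow> 'b list" and C :: "'b set"
  assumes substitution: "substitution \<theta>"
    and finite_letters: "finite C"
    and set_letter: "a \<in> C \<Longrightarrow> set (\<theta> [a]) = C"
    and length_letter: "a \<in> C \<Longrightarrow> 2 \<le> length (\<theta> [a])"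
begin

lemmas funpow_substitution = substitution_funpow[OF substitution]

lemma set_funpow_letter:
  assumes "a \<in> C" "n \<ge> 1"
  shows "set ((\<theta> ^^ n) [a]) = C"
  using assms(2)
proof (induction n rule: nat_induct_at_least)
  case (Suc n)
  have "set ((\<theta> ^^ Suc n) [a]) = (\<Union>b\<in>set ((\<theta> ^^ n) [a]). set (\<theta> [b]))"
    by (simp add: set_substitution[OF substitution, of "(\<theta> ^^ n) [a]"])
  also have "\<dots> = C" using Suc.IH set_letter \<open>a \<in> C\<close> by auto
  finally show ?case .
qed (simp add: set_letter \<open>a \<in> C\<close>)

lemma set_funpow_letter_subset: "a \<in> C \<Longrightarrow> set ((\<theta> ^^ n) [a]) \<subseteq> C"
  by (cases "n = 0") (simp_all add: set_funpow_letter)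

lemma length_funpow_ge:
  assumes "set u \<subseteq> C"
  shows "2 ^ n * length u \<le> length ((\<theta> ^^ n) u)"
  using assms
proof (induction n arbitrary: u)
  case (Suc n)
  have "2 * length u \<le> length (\<theta> u)"
    using Suc.prems
  proof (induction u)
    case (Cons a u)
    then show ?case
      using length_letter[of a] substitution_append[OF substitution, of "[a]" u] by simp
  qed simp
  then have "2 ^ Suc n * length u \<le> 2 ^ n * length (\<theta> u)" by simp
  also have "set (\<theta> u) \<subseteq> C"
    unfolding set_substitution[OF substitution, of u] using set_letter Suc.prems by auto
  then have "2 ^ n * length (\<theta> u) \<le> length ((\<theta> ^^ n) (\<theta> u))" by (rule Suc.IH)
  finally show ?case by (simp add: funpow_swap1)
qed simp

lemma length_funpow_letter_ge: "a \<in> C \<Longrightarrow> 2 ^ n \<le> length ((\<theta> ^^ n) [a])"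
  using length_funpow_ge[of "[a]" n] by simp

lemma length_funpow_letter_pos: "a \<in> C \<Longrightarrow> 0 < length ((\<theta> ^^ n) [a])"
  by (rule less_le_trans[OF _ length_funpow_letter_ge]) simp_all

lemma length_comparable:
  obtains d :: real
  where "d > 0" "\<And>a b n. a \<in> C \<Longrightarrow> b \<in> C \<Longrightarrow> d * length ((\<theta> ^^ Suc n) [a]) \<le> length ((\<theta> ^^ n) [b])"
proof -
  define K where "K = Max (insert 1 ((\<lambda>a. length (\<theta> [a])) ` C))"
  have "length (\<theta> [a]) \<le> K" if "a \<in> C" for a
    unfolding K_def using that finite_letters by (intro Max_ge) auto
  then have K: "length (\<theta> u) \<le> K * length u" if "set u \<subseteq> C" for u
    unfolding substitution_eq_concat[OF substitution, of u] length_concat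
    using sum_list_mono[of u "\<lambda>a. length (\<theta> [a])" "\<lambda>_. K"] that
    by (auto simp: comp_def sum_list_triv mult.commute)
  have "length ((\<theta> ^^ Suc n) [a]) \<le> K * K * length ((\<theta> ^^ n) [b])" if "a \<in> C" "b \<in> C" for a b n
  proof -
    have "length ((\<theta> ^^ Suc n) [a]) \<le> K * length ((\<theta> ^^ n) [a])"
      using K[OF set_funpow_letter_subset[OF \<open>a \<in> C\<close>]] by simp
    also have "sublist ((\<theta> ^^ n) [a]) ((\<theta> ^^ n) (\<theta> [b]))"
      using that set_letter by (intro sublist_substitution_letter funpow_substitution) simp
    then have "length ((\<theta> ^^ n) [a]) \<le> length (\<theta> ((\<theta> ^^ n) [b]))"
      unfolding funpow_swap1 by (rule sublist_length_le)
    also have "\<dots> \<le> K * length ((\<theta> ^^ n) [b])"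
      using K[OF set_funpow_letter_subset[OF \<open>b \<in> C\<close>]] .
    finally show ?thesis by simp
  qed
  then have "real (length ((\<theta> ^^ Suc n) [a])) \<le> K * K * length ((\<theta> ^^ n) [b])"
    if "a \<in> C" "b \<in> C" for a b n
    using that by (metis of_nat_le_iff of_nat_mult)
  moreover have "K \<ge> 1" unfolding K_def using finite_letters by (intro Max_ge) auto
  ultimately show thesis by (intro that[of "1 / (real K * K)"]) (simp_all add: field_simps)
qed

definition block_mean :: "('b list \<Rightarrow> real) \<Rightarrow> nat \<Rightarrow> 'b \<Rightarrow> real" where
  "block_mean f n a = f ((\<theta> ^^ n) [a]) / length ((\<theta> ^^ n) [a])"

lemma block_mean_mult_length:
  "a \<in> C \<Longrightarrow> block_mean f n a * length ((\<theta> ^^ n) [a]) = f ((\<theta> ^^ n) [a])"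
  using length_funpow_letter_pos[of a n] by (simp add: block_mean_def)

lemma block_mean_uminus: "block_mean (\<lambda>w. - f w) n a = - block_mean f n a"
  by (simp add: block_mean_def)

lemma quasi_additive_funpow_Suc_le:
  assumes f: "quasi_additive K f" and a: "a \<in> C" and b: "b \<in> C"
    and nonpos: "\<And>x. x \<in> C \<Longrightarrow> f ((\<theta> ^^ n) [x]) \<le> 0"
  shows "f ((\<theta> ^^ Suc n) [a])
    \<le> f ((\<theta> ^^ n) [b]) + 2 * K * (1 / 2) ^ n * length ((\<theta> ^^ Suc n) [a])"
proof -
  define bs where "bs = map (\<lambda>x. (\<theta> ^^ n) [x]) (\<theta> [a])"
  have concat: "(\<theta> ^^ Suc n) [a] = concat bs"
    unfolding bs_def using substitution_eq_concat[OF funpow_substitution, of n "\<theta> [a]"]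
    by (simp only: funpow_Suc_right comp_apply)
  have "f ((\<theta> ^^ Suc n) [a]) \<le> f ((\<theta> ^^ n) [b]) + K * (1 + length bs)"
    unfolding concat
    by (rule quasi_additive_concat_le_member[OF f])
      (use b nonpos set_letter[OF a] in \<open>auto simp: bs_def\<close>)
  moreover have "K * (1 + length bs) \<le> 2 * K * (1 / 2) ^ n * length ((\<theta> ^^ Suc n) [a])"
  proof -
    have "2 ^ n * length bs \<le> length ((\<theta> ^^ Suc n) [a])"
      using length_funpow_ge[of "\<theta> [a]" n] set_letter[OF a] by (simp add: bs_def funpow_swap1)
    then have "length bs \<le> (1 / 2) ^ n * length ((\<theta> ^^ Suc n) [a])"
      by (simp add: field_simps flip: of_nat_le_iff[where 'a = real])
    moreover have "2 \<le> length bs" using length_letter[OF a] by (simp add: bs_def)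
    ultimately have "1 + length bs \<le> 2 * ((1 / 2) ^ n * length ((\<theta> ^^ Suc n) [a]))" by linarith
    from mult_left_mono[OF this quasi_additive_nonneg[OF f]] show ?thesis by (simp add: mult_ac)
  qed
  ultimately show ?thesis by linarith
qed

text \<open>Subtracting \<open>m\<close> times the length from \<open>f\<close> makes all level-\<open>n\<close> blocks nonpositive.\<close>

lemma block_mean_Suc_le:
  fixes d :: real
  assumes f: "quasi_additive K f" and a: "a \<in> C" and b: "b \<in> C"
    and m: "\<And>x. x \<in> C \<Longrightarrow> block_mean f n x \<le> m"
    and d: "d * length ((\<theta> ^^ Suc n) [a]) \<le> length ((\<theta> ^^ n) [b])"
  shows "block_mean f (Suc n) a \<le> m - d * (m - block_mean f n b) + 2 * K * (1 / 2) ^ n"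
proof -
  define g where "g w = f w - m * length w" for w
  define len where "len = real (length ((\<theta> ^^ Suc n) [a]))"
  have len_pos: "len > 0"
    unfolding len_def using length_funpow_letter_pos[OF a, of "Suc n"] by linarith
  have g_block: "g ((\<theta> ^^ n) [x]) = (block_mean f n x - m) * length ((\<theta> ^^ n) [x])"
    if "x \<in> C" for x
    using that by (simp add: g_def left_diff_distrib block_mean_mult_length)
  have "g ((\<theta> ^^ Suc n) [a]) \<le> g ((\<theta> ^^ n) [b]) + 2 * K * (1 / 2) ^ n * len"
    unfolding len_def
  proof (rule quasi_additive_funpow_Suc_le[OF _ a b])
    show "quasi_additive K g" unfolding g_def using f by (rule quasi_additive_diff_length)
    show "g ((\<theta> ^^ n) [x]) \<le> 0" if "x \<in> C" for x
      unfolding g_block[OF that] using m[OF that] by (simp add: mult_nonpos_nonneg)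
  qed
  moreover have "g ((\<theta> ^^ n) [b]) \<le> - d * (m - block_mean f n b) * len"
    using mult_left_mono[OF d, of "m - block_mean f n b"] m[OF b]
    by (simp add: g_block[OF b] len_def algebra_simps)
  moreover have "g ((\<theta> ^^ Suc n) [a]) = (block_mean f (Suc n) a - m) * len"
    unfolding g_def len_def using block_mean_mult_length[OF a, of f "Suc n"]
    by (simp add: left_diff_distrib)
  ultimately have "(block_mean f (Suc n) a - m) * len
      \<le> (- d * (m - block_mean f n b) + 2 * K * (1 / 2) ^ n) * len"
    unfolding distrib_right by linarith
  then show ?thesis using len_pos by (simp add: mult_le_cancel_right)
qed

lemma block_mean_tendsto:
  assumes f: "quasi_additive K f"
  shows "\<exists>c. \<forall>a\<in>C. (\<lambda>n. block_mean f n a) \<longlonglongrightarrow> c"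
proof (cases "C = {}")
  case False
  obtain d :: real where d: "d > 0"
    "\<And>a b n. a \<in> C \<Longrightarrow> b \<in> C \<Longrightarrow> d * length ((\<theta> ^^ Suc n) [a]) \<le> length ((\<theta> ^^ n) [b])"
    using length_comparable by blast
  show ?thesis
  proof (rule oscillation_contraction[OF finite_letters False d(1)])
    show "summable (\<lambda>n. 2 * K * (1 / 2) ^ n)" by (intro summable_mult summable_geometric) simp
    show "0 \<le> 2 * K * (1 / 2) ^ n" for n using quasi_additive_nonneg[OF f] by simp
    show "block_mean f (Suc n) a \<le> m - d * (m - block_mean f n b) + 2 * K * (1 / 2) ^ n"
      if "a \<in> C" "b \<in> C" "\<And>x. x \<in> C \<Longrightarrow> block_mean f n x \<le> m" for n a b m
      using block_mean_Suc_le[OF f that d(2)[OF that(1,2)]] .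
    show "m - 2 * K * (1 / 2) ^ n \<le> block_mean f (Suc n) a"
      if a: "a \<in> C" and m: "\<And>x. x \<in> C \<Longrightarrow> m \<le> block_mean f n x" for n a m
    proof -
      have "- block_mean f (Suc n) a \<le> - m - d * (block_mean f n a - m) + 2 * K * (1 / 2) ^ n"
        using block_mean_Suc_le[OF quasi_additive_uminus[OF f] a a _ d(2)[OF a a], of n "- m"] m
        by (simp add: block_mean_uminus algebra_simps)
      moreover have "0 \<le> d * (block_mean f n a - m)" using d(1) m[OF a] by simp
      ultimately show ?thesis by linarith
    qed
  qed
qed simp

definition language :: "'b list set" where
  "language = {w. \<exists>n. \<exists>a\<in>C. sublist w ((\<theta> ^^ n) [a])}"

lemma set_language: "w \<in> language \<Longrightarrow> set w \<subseteq> C"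
  unfolding language_def using set_funpow_letter_subset set_mono_sublist by fastforce

lemma language_sublist: "w \<in> language \<Longrightarrow> sublist u w \<Longrightarrow> u \<in> language"
  unfolding language_def by (blast intro: sublist_order.order.trans)

lemma language_sublist_funpow:
  assumes "w \<in> language"
  shows "\<exists>v. set v \<subseteq> C \<and> sublist w ((\<theta> ^^ n) v)"
proof -
  obtain k a where a: "a \<in> C" "sublist w ((\<theta> ^^ k) [a])"
    using assms by (auto simp: language_def)
  have "a \<in> set ((\<theta> ^^ n) [a])" using a(1) by (cases "n = 0") (simp_all add: set_funpow_letter)
  then have "sublist ((\<theta> ^^ k) [a]) ((\<theta> ^^ k) ((\<theta> ^^ n) [a]))"
    by (rule sublist_substitution_letter[OF funpow_substitution])
  also have "(\<theta> ^^ k) ((\<theta> ^^ n) [a]) = (\<theta> ^^ n) ((\<theta> ^^ k) [a])"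
    by (metis add.commute comp_apply funpow_add)
  finally have "sublist ((\<theta> ^^ k) [a]) ((\<theta> ^^ n) ((\<theta> ^^ k) [a]))" .
  then show ?thesis
    using sublist_order.order.trans[OF a(2)] set_funpow_letter_subset[OF a(1)] by blast
qed

lemma language_block_decomposition:
  assumes "w \<in> language" and K: "\<And>a. a \<in> C \<Longrightarrow> length ((\<theta> ^^ n) [a]) \<le> K"
  shows "\<exists>s bs p. w = s @ concat bs @ p \<and> set bs \<subseteq> (\<lambda>a. (\<theta> ^^ n) [a]) ` C \<and>
    length s \<le> K \<and> length p \<le> K"
proof -
  obtain v where v: "set v \<subseteq> C" "sublist w ((\<theta> ^^ n) v)"
    using language_sublist_funpow[OF assms(1)] by blast
  have "sublist w (concat (map (\<lambda>a. (\<theta> ^^ n) [a]) v))"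
    using v(2) substitution_eq_concat[OF funpow_substitution, of n v] by simp
  then obtain s bs p where "w = s @ concat bs @ p" "set bs \<subseteq> set (map (\<lambda>a. (\<theta> ^^ n) [a]) v)"
    "length s \<le> K" "length p \<le> K"
    using sublist_concatD[of w _ K] K v(1)
    by (metis (no_types, lifting) image_iff list.set_map subsetD)
  moreover from this v(1) have "set bs \<subseteq> (\<lambda>a. (\<theta> ^^ n) [a]) ` C" by auto
  ultimately show ?thesis by (intro exI[of _ s] exI[of _ bs] exI[of _ p]) simp
qed

lemma ex_level_blocks_small:
  fixes e :: real
  assumes lim: "\<And>a. a \<in> C \<Longrightarrow> (\<lambda>n. block_mean f n a) \<longlonglongrightarrow> 0" and e: "e > 0"
  shows "\<exists>n. \<forall>a\<in>C. \<bar>f ((\<theta> ^^ n) [a])\<bar> + K \<le> e * length ((\<theta> ^^ n) [a])"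
proof -
  have "\<forall>\<^sub>F n in sequentially. \<forall>a\<in>C. \<bar>block_mean f n a\<bar> < e / 2"
    using lim tendstoD[of _ 0 sequentially "e / 2"] e
    by (intro eventually_ball_finite finite_letters ballI) (force simp: dist_real_def)
  moreover have "(\<lambda>n. K * (1 / 2) ^ n) \<longlonglongrightarrow> K * 0"
    by (intro tendsto_mult_left LIMSEQ_power_zero) simp
  then have "\<forall>\<^sub>F n in sequentially. K * (1 / 2) ^ n < e / 2"
    by (rule order_tendstoD) (use e in simp)
  ultimately obtain n where n: "\<And>a. a \<in> C \<Longrightarrow> \<bar>block_mean f n a\<bar> < e / 2" "K * (1 / 2) ^ n < e / 2"
    using eventually_happens'[OF sequentially_bot eventually_conj] by blast
  have "\<bar>f ((\<theta> ^^ n) [a])\<bar> + K \<le> e * length ((\<theta> ^^ n) [a])" if a: "a \<in> C" for a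
  proof -
    let ?b = "(\<theta> ^^ n) [a]"
    have "\<bar>f ?b\<bar> = \<bar>block_mean f n a\<bar> * length ?b"
      using block_mean_mult_length[OF a, of f n] by (metis abs_mult abs_of_nat)
    also have "\<dots> \<le> e / 2 * length ?b" using n(1)[OF a] by (intro mult_right_mono) auto
    finally have "\<bar>f ?b\<bar> \<le> e / 2 * length ?b" .
    moreover have "(2::real) ^ n \<le> length ?b"
      using length_funpow_letter_ge[OF a, of n] by (metis of_nat_le_iff of_nat_numeral of_nat_power)
    then have "e / 2 * 2 ^ n \<le> e / 2 * length ?b" using e by simp
    moreover have "K \<le> e / 2 * 2 ^ n" using n(2) by (simp add: field_simps)
    ultimately show ?thesis by linarith
  qed
  then show ?thesis by blast
qed

lemma language_bound_of_small_blocks: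
  fixes e :: real
  assumes f: "quasi_additive K f" and "e \<ge> 0"
    and small: "\<And>a. a \<in> C \<Longrightarrow> \<bar>f ((\<theta> ^^ n) [a])\<bar> + K \<le> e * length ((\<theta> ^^ n) [a])"
  shows "\<exists>D. \<forall>w\<in>language. \<bar>f w\<bar> \<le> e * length w + D"
proof (intro exI ballI)
  define M where "M = Max (insert 0 ((\<lambda>a. length ((\<theta> ^^ n) [a])) ` C))"
  have M: "length ((\<theta> ^^ n) [a]) \<le> M" if "a \<in> C" for a
    unfolding M_def using finite_letters that by (intro Max_ge) auto
  define B where "B = Max (insert 0 ((\<lambda>u. \<bar>f u\<bar>) ` {u. set u \<subseteq> C \<and> length u \<le> M}))"
  have B: "\<bar>f u\<bar> \<le> B" if "set u \<subseteq> C" "length u \<le> M" for u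
    unfolding B_def using finite_lists_length_le[OF finite_letters] that by (intro Max_ge) auto
  fix w assume w: "w \<in> language"
  obtain s bs p where decomp: "w = s @ concat bs @ p" "set bs \<subseteq> (\<lambda>a. (\<theta> ^^ n) [a]) ` C"
    "length s \<le> M" "length p \<le> M"
    using language_block_decomposition[OF w M] by blast
  have "set s \<subseteq> C" "set p \<subseteq> C" using set_language[OF w] decomp(1) by auto
  then have "\<bar>f s\<bar> \<le> B" "\<bar>f p\<bar> \<le> B" using B decomp(3,4) by auto
  moreover have "\<bar>f (concat bs)\<bar> \<le> e * length (concat bs) + K"
    by (rule quasi_additive_concat_small[OF f]) (use small decomp(2) in blast)
  moreover have "e * length (concat bs) \<le> e * length w"
    using \<open>e \<ge> 0\<close> by (intro mult_left_mono) (simp_all add: decomp(1))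
  ultimately show "\<bar>f w\<bar> \<le> e * length w + (2 * B + 3 * K)"
    using quasi_additiveD[OF f, of s "concat bs @ p"] quasi_additiveD[OF f, of "concat bs" p]
    unfolding decomp(1) by linarith
qed

lemma tendsto_zero_on_language:
  assumes f: "quasi_additive K f" and lim: "\<And>a. a \<in> C \<Longrightarrow> (\<lambda>n. block_mean f n a) \<longlonglongrightarrow> 0"
  shows "((\<lambda>w. f w / length w) \<longlongrightarrow> 0) (long_words language)"
proof (rule tendstoI)
  fix e :: real assume e: "e > 0"
  obtain n where "\<And>a. a \<in> C \<Longrightarrow> \<bar>f ((\<theta> ^^ n) [a])\<bar> + K \<le> e / 2 * length ((\<theta> ^^ n) [a])"
    using ex_level_blocks_small[OF lim, of "e / 2" K] e by auto
  then obtain D where D: "\<And>w. w \<in> language \<Longrightarrow> \<bar>f w\<bar> \<le> e / 2 * length w + D"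
    using language_bound_of_small_blocks[OF f, of "e / 2" n] e by auto
  obtain N :: nat where N: "D / (e / 2) < N" using reals_Archimedean2 by blast
  have "dist (f w / length w) 0 < e" if "w \<in> language" "N + 1 \<le> length w" for w
  proof -
    have "D / (e / 2) < length w" using N that(2) by linarith
    then have "D < e / 2 * length w" using e by (simp add: field_simps)
    then have "\<bar>f w\<bar> < e * length w" using D[OF that(1)] by linarith
    moreover have "length w > 0" using that(2) by linarith
    ultimately show ?thesis by (simp add: field_simps)
  qed
  then show "\<forall>\<^sub>F w in long_words language. dist (f w / length w) 0 < e"
    unfolding eventually_long_words by blast
qed

theorem uniform_frequency:
  assumes f: "quasi_additive K f"
  shows "\<exists>c. ((\<lambda>w. f w / length w) \<longlongrightarrow> c) (long_words language)"
proof -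
  obtain c where c: "\<And>a. a \<in> C \<Longrightarrow> (\<lambda>n. block_mean f n a) \<longlonglongrightarrow> c"
    using block_mean_tendsto[OF f] by blast
  define g where "g w = f w - c * length w" for w
  have g_mean: "g w / length w = f w / length w - c" if "w \<noteq> []" for w
    using that by (simp add: g_def diff_divide_distrib)
  have "((\<lambda>w. g w / length w) \<longlongrightarrow> 0) (long_words language)"
  proof (rule tendsto_zero_on_language)
    show "quasi_additive K g" unfolding g_def using f by (rule quasi_additive_diff_length)
    show "(\<lambda>n. block_mean g n a) \<longlonglongrightarrow> 0" if "a \<in> C" for a
    proof -
      have "block_mean g n a = block_mean f n a - c" for n
        using g_mean length_funpow_letter_pos[OF that] by (simp add: block_mean_def)
      then show ?thesis using LIM_zero[OF c[OF that]] by simp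
    qed
  qed
  moreover have "\<forall>\<^sub>F w in long_words language. g w / length w = f w / length w - c"
    unfolding eventually_long_words
  proof (intro exI[of _ 1] ballI impI)
    fix w :: "'b list" assume "1 \<le> length w"
    then have "w \<noteq> []" by (cases w) simp_all
    then show "g w / length w = f w / length w - c" by (rule g_mean)
  qed
  ultimately have "((\<lambda>w. f w / length w - c) \<longlongrightarrow> 0) (long_words language)"
    by (rule Lim_transform_eventually)
  then have "((\<lambda>w. f w / length w) \<longlongrightarrow> c) (long_words language)" by (rule LIM_zero_cancel)
  then show ?thesis ..
qed

end

section \<open>Unique ergodicity from pointwise averages\<close>

definition birkhoff_average :: "('x \<Rightarrow> 'x) \<Rightarrow> ('x \<Rightarrow> real) \<Rightarrow> nat \<Rightarrow> 'x \<Rightarrow> real" where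
  "birkhoff_average T f N y = (\<Sum>i<N. f ((T ^^ i) y)) / N"

lemma funpow_mem: "T ` Y \<subseteq> Y \<Longrightarrow> y \<in> Y \<Longrightarrow> (T ^^ n) y \<in> Y"
  by (induction n) auto

lemma birkhoff_average_indicator_bounds:
  "0 \<le> birkhoff_average T (indicator B) N y" "birkhoff_average T (indicator B) N y \<le> 1"
proof -
  have "(\<Sum>i<N. indicat_real B ((T ^^ i) y)) \<le> (\<Sum>i<N. 1)"
    by (intro sum_mono) (simp add: indicator_def)
  then show "birkhoff_average T (indicator B) N y \<le> 1"
    by (cases "N = 0") (simp_all add: birkhoff_average_def divide_le_eq_1)
qed (simp add: birkhoff_average_def sum_nonneg)

lemma birkhoff_average_disjoint_Un:
  assumes "B \<inter> D = {}"
  shows "birkhoff_average T (indicator (B \<union> D)) N y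
    = birkhoff_average T (indicator B) N y + birkhoff_average T (indicator D) N y"
  using assms
  by (simp add: birkhoff_average_def indicator_disj_union sum.distrib add_divide_distrib)

lemma birkhoff_average_invariant_set:
  assumes "T ` Y \<subseteq> Y" "y \<in> Y" "N \<ge> 1"
  shows "birkhoff_average T (indicator Y) N y = 1"
  using assms by (simp add: birkhoff_average_def funpow_mem)

lemma birkhoff_average_vimage:
  assumes "T ` Y \<subseteq> Y" "y \<in> Y"
  shows "birkhoff_average T (indicator (T -` B \<inter> Y)) N y = birkhoff_average T (indicator B) N (T y)"
  using funpow_mem[OF assms] by (simp add: birkhoff_average_def indicator_def funpow_swap1)

lemma (in prob_space) prob_eq_limit_birkhoff_average:
  assumes T: "T \<in> M \<rightarrow>\<^sub>M M" "distr M M T = M" and B: "B \<in> events"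
    and lim: "\<And>y. y \<in> space M \<Longrightarrow> (\<lambda>N. birkhoff_average T (indicator B) N y) \<longlonglongrightarrow> c"
  shows "prob B = c"
proof -
  have pow: "T ^^ i \<in> M \<rightarrow>\<^sub>M M \<and> distr M M (T ^^ i) = M" for i
  proof (induction i)
    case (Suc i)
    then have "distr M M (T ^^ Suc i) = distr (distr M M (T ^^ i)) M T"
      using distr_distr[OF T(1), of "T ^^ i" M] by simp
    then show ?case using Suc T measurable_comp[of "T ^^ i" M M T M] by (simp add: comp_def)
  qed (simp add: id_def)
  have [measurable]: "(\<lambda>y. indicat_real B ((T ^^ i) y)) \<in> borel_measurable M" for i
    using measurable_compose[of "T ^^ i" M M "indicat_real B" borel] pow B by simp
  have "(\<integral>y. indicat_real B ((T ^^ i) y) \<partial>M) = prob B" for i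
    using integral_distr[of "T ^^ i" M M "indicat_real B"] pow[of i] B by simp
  moreover have "integrable M (\<lambda>y. indicat_real B ((T ^^ i) y))" for i
    by (rule integrable_const_bound[of _ 1]) (simp add: indicator_def, measurable)
  ultimately have average: "(\<integral>y. birkhoff_average T (indicator B) N y \<partial>M) = prob B" if "N \<ge> 1" for N
    using that by (simp add: birkhoff_average_def)
  have "(\<lambda>N. \<integral>y. birkhoff_average T (indicator B) N y \<partial>M) \<longlonglongrightarrow> (\<integral>y. c \<partial>M)"
  proof (rule integral_dominated_convergence[where w = "\<lambda>_. 1"])
    show "birkhoff_average T (indicator B) N \<in> borel_measurable M" for N
      unfolding birkhoff_average_def[abs_def] by measurable
    show "AE y in M. (\<lambda>N. birkhoff_average T (indicator B) N y) \<longlonglongrightarrow> c"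
      by (rule AE_I2) (rule lim)
  qed (simp_all add: birkhoff_average_indicator_bounds)
  moreover have "(\<lambda>N. \<integral>y. birkhoff_average T (indicator B) N y \<partial>M) \<longlonglongrightarrow> prob B"
    by (rule tendsto_eventually, rule eventually_sequentiallyI[of 1]) (rule average)
  ultimately show ?thesis using LIMSEQ_unique prob_space by fastforce
qed

context Sigma_Algebra.algebra
begin

lemma prob_space_eqI_generator:
  assumes "prob_space \<mu>" "sets \<mu> = sigma_sets \<Omega> M" "sets \<nu> = sigma_sets \<Omega> M"
    and "\<And>C. C \<in> M \<Longrightarrow> emeasure \<mu> C = emeasure \<nu> C"
  shows "\<mu> = \<nu>"
proof (rule measure_eqI_generator_eq[of M \<Omega> \<mu> \<nu> "\<lambda>_. \<Omega>"])
  show "Int_stable M" by (auto simp: Int_stable_def)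
  interpret prob_space \<mu> by fact
  show "emeasure \<mu> \<Omega> \<noteq> \<infinity>" by simp
qed (use assms space_closed in auto)

lemma space_eq_generator: "sets \<mu> = sigma_sets \<Omega> M \<Longrightarrow> space \<mu> = \<Omega>"
  using sets_eq_imp_space_eq[of \<mu> "sigma \<Omega> M"] space_closed by simp

lemma measurable_generator:
  assumes "sets \<mu> = sigma_sets \<Omega> M" and "T ` \<Omega> \<subseteq> \<Omega>" and "\<And>C. C \<in> M \<Longrightarrow> T -` C \<inter> \<Omega> \<in> M"
  shows "T \<in> \<mu> \<rightarrow>\<^sub>M \<mu>"
proof (rule measurable_sigma_sets[OF assms(1) space_closed])
  show "T \<in> space \<mu> \<rightarrow> \<Omega>" using assms(2) space_eq_generator[OF assms(1)] by auto
  show "T -` C \<inter> space \<mu> \<in> sets \<mu>" if "C \<in> M" for C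
    using assms(3)[OF that] assms(1) space_eq_generator[OF assms(1)] by auto
qed

lemma ex_prob_space_extension:
  fixes c :: "'a set \<Rightarrow> real"
  assumes nonneg: "\<And>C. C \<in> M \<Longrightarrow> 0 \<le> c C"
    and disjoint_Un: "\<And>C D. C \<in> M \<Longrightarrow> D \<in> M \<Longrightarrow> C \<inter> D = {} \<Longrightarrow> c (C \<union> D) = c C + c D"
    and total: "c \<Omega> = 1"
    and nest: "\<And>A :: nat \<Rightarrow> 'a set. range A \<subseteq> M \<Longrightarrow> decseq A \<Longrightarrow> (\<Inter>i. A i) = {} \<Longrightarrow> \<exists>i. A i = {}"
  shows "\<exists>\<mu>. prob_space \<mu> \<and> sets \<mu> = sigma_sets \<Omega> M \<and> (\<forall>C\<in>M. emeasure \<mu> C = ennreal (c C))"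
proof -
  have empty: "c {} = 0" using disjoint_Un[of "{}" "{}"] by simp
  have "\<exists>m. (\<forall>C\<in>M. m C = ennreal (c C)) \<and> measure_space \<Omega> (sigma_sets \<Omega> M) m"
  proof (rule caratheodory_empty_continuous)
    show "positive M (\<lambda>C. ennreal (c C))" by (simp add: positive_def empty)
    show "additive M (\<lambda>C. ennreal (c C))"
      by (simp add: additive_def disjoint_Un nonneg)
    fix A :: "nat \<Rightarrow> 'a set"
    assume A: "range A \<subseteq> M" "decseq A" "(\<Inter>i. A i) = {}"
    then obtain i where "A i = {}" using nest by blast
    then have "A j = {}" if "j \<ge> i" for j using decseqD[OF A(2) that] by simp
    then show "(\<lambda>i. ennreal (c (A i))) \<longlonglongrightarrow> 0"
      by (intro tendsto_eventually eventually_sequentiallyI[of i]) (simp add: empty)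
  qed simp
  then obtain m where m: "\<And>C. C \<in> M \<Longrightarrow> m C = ennreal (c C)"
    "measure_space \<Omega> (sigma_sets \<Omega> M) m" by blast
  define \<mu> where "\<mu> = measure_of \<Omega> M m"
  have sets: "sets \<mu> = sigma_sets \<Omega> M" unfolding \<mu>_def using space_closed by simp
  have "emeasure \<mu> C = ennreal (c C)" if "C \<in> M" for C
    unfolding m(1)[OF that, symmetric]
    by (rule emeasure_measure_of[OF \<mu>_def space_closed])
      (use m(2) that in \<open>auto simp: measure_space_def sets\<close>)
  moreover from this[of \<Omega>] have "prob_space \<mu>"
    by (intro prob_spaceI) (simp add: space_eq_generator[OF sets] total)
  ultimately show ?thesis using sets by blast
qed

lemma ex_invariant_prob_space:
  fixes c :: "'a set \<Rightarrow> real"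
  assumes T: "T ` \<Omega> \<subseteq> \<Omega>" "\<And>C. C \<in> M \<Longrightarrow> T -` C \<inter> \<Omega> \<in> M"
    and nest: "\<And>A :: nat \<Rightarrow> 'a set. range A \<subseteq> M \<Longrightarrow> decseq A \<Longrightarrow> (\<Inter>i. A i) = {} \<Longrightarrow> \<exists>i. A i = {}"
    and y: "y \<in> \<Omega>"
    and lim: "\<And>C z. C \<in> M \<Longrightarrow> z \<in> \<Omega> \<Longrightarrow> (\<lambda>N. birkhoff_average T (indicator C) N z) \<longlonglongrightarrow> c C"
  shows "\<exists>\<mu>. prob_space \<mu> \<and> sets \<mu> = sigma_sets \<Omega> M \<and> distr \<mu> \<mu> T = \<mu>"
proof -
  have "\<exists>\<mu>. prob_space \<mu> \<and> sets \<mu> = sigma_sets \<Omega> M \<and> (\<forall>C\<in>M. emeasure \<mu> C = ennreal (c C))"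
  proof (rule ex_prob_space_extension[OF _ _ _ nest])
    show "0 \<le> c C" if "C \<in> M" for C
      by (rule LIMSEQ_le_const[OF lim[OF that y]]) (simp add: birkhoff_average_indicator_bounds)
    show "c (C \<union> D) = c C + c D" if "C \<in> M" "D \<in> M" "C \<inter> D = {}" for C D
      using tendsto_add[OF lim[OF that(1) y] lim[OF that(2) y]] lim[OF Un[OF that(1,2)] y]
      unfolding birkhoff_average_disjoint_Un[OF that(3)] by (rule LIMSEQ_unique[rotated])
    have "(\<lambda>N. birkhoff_average T (indicator \<Omega>) N y) \<longlonglongrightarrow> 1"
      by (rule tendsto_eventually, rule eventually_sequentiallyI[of 1])
        (simp add: birkhoff_average_invariant_set[OF T(1) y])
    then show "c \<Omega> = 1" using lim[OF top y] LIMSEQ_unique by blast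
  qed
  then obtain \<mu> where \<mu>: "prob_space \<mu>" "sets \<mu> = sigma_sets \<Omega> M"
    "\<And>C. C \<in> M \<Longrightarrow> emeasure \<mu> C = ennreal (c C)" by blast
  have T_meas: "T \<in> \<mu> \<rightarrow>\<^sub>M \<mu>" using measurable_generator[OF \<mu>(2) T] .
  have "distr \<mu> \<mu> T = \<mu>"
  proof (rule prob_space_eqI_generator)
    show "prob_space (distr \<mu> \<mu> T)" using \<mu>(1) T_meas by (rule prob_space.prob_space_distr)
    fix C assume C: "C \<in> M"
    have "(\<lambda>N. birkhoff_average T (indicator (T -` C \<inter> \<Omega>)) N y) \<longlonglongrightarrow> c C"
      unfolding birkhoff_average_vimage[OF T(1) y] using lim[OF C] T(1) y by blast
    then have "c (T -` C \<inter> \<Omega>) = c C" using lim[OF T(2)[OF C] y] LIMSEQ_unique by blast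
    then show "emeasure (distr \<mu> \<mu> T) C = emeasure \<mu> C"
      using C \<mu> T(2) T_meas by (simp add: emeasure_distr space_eq_generator)
  qed (simp_all add: \<mu>(2))
  then show ?thesis using \<mu> by blast
qed

lemma ex1_invariant_prob_space:
  assumes T: "T ` \<Omega> \<subseteq> \<Omega>" "\<And>C. C \<in> M \<Longrightarrow> T -` C \<inter> \<Omega> \<in> M"
    and nest: "\<And>A :: nat \<Rightarrow> 'a set. range A \<subseteq> M \<Longrightarrow> decseq A \<Longrightarrow> (\<Inter>i. A i) = {} \<Longrightarrow> \<exists>i. A i = {}"
    and "\<Omega> \<noteq> {}"
    and lim: "\<And>C. C \<in> M \<Longrightarrow> \<exists>c. \<forall>y\<in>\<Omega>. (\<lambda>N. birkhoff_average T (indicator C) N y) \<longlonglongrightarrow> c"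
  shows "\<exists>!\<mu>. prob_space \<mu> \<and> sets \<mu> = sigma_sets \<Omega> M \<and> distr \<mu> \<mu> T = \<mu>"
proof -
  obtain c where c: "\<And>C y. C \<in> M \<Longrightarrow> y \<in> \<Omega> \<Longrightarrow> (\<lambda>N. birkhoff_average T (indicator C) N y) \<longlonglongrightarrow> c C"
    using bchoice[of M "\<lambda>C c. \<forall>y\<in>\<Omega>. (\<lambda>N. birkhoff_average T (indicator C) N y) \<longlonglongrightarrow> c"] lim
    by blast
  have determined: "emeasure \<mu> C = ennreal (c C)"
    if "prob_space \<mu>" and sets: "sets \<mu> = sigma_sets \<Omega> M" and "distr \<mu> \<mu> T = \<mu>" and C: "C \<in> M"
    for \<mu> C
  proof -
    interpret prob_space \<mu> by fact
    have "prob C = c C"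
    proof (rule prob_eq_limit_birkhoff_average)
      show "T \<in> \<mu> \<rightarrow>\<^sub>M \<mu>" using measurable_generator[OF sets T] .
      show "(\<lambda>N. birkhoff_average T (indicator C) N y) \<longlonglongrightarrow> c C" if "y \<in> space \<mu>" for y
        using c[OF C] that space_eq_generator[OF sets] by simp
    qed (use \<open>distr \<mu> \<mu> T = \<mu>\<close> C in \<open>simp_all add: sets\<close>)
    then show ?thesis by (simp add: emeasure_eq_measure)
  qed
  obtain y where "y \<in> \<Omega>" using \<open>\<Omega> \<noteq> {}\<close> by blast
  from ex_invariant_prob_space[OF T nest this c]
  obtain \<mu> where \<mu>: "prob_space \<mu>" "sets \<mu> = sigma_sets \<Omega> M" "distr \<mu> \<mu> T = \<mu>" by blast
  show ?thesis
  proof (rule ex1I[of _ \<mu>])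
    fix \<nu> assume \<nu>: "prob_space \<nu> \<and> sets \<nu> = sigma_sets \<Omega> M \<and> distr \<nu> \<nu> T = \<nu>"
    show "\<nu> = \<mu>"
      by (rule prob_space_eqI_generator) (use \<mu> \<nu> determined in simp_all)
  qed (use \<mu> in blast)
qed

end

lemma distr_eq_self_iff:
  assumes "T \<in> \<mu> \<rightarrow>\<^sub>M \<mu>"
  shows "distr \<mu> \<mu> T = \<mu> \<longleftrightarrow> (\<forall>B\<in>sets \<mu>. emeasure \<mu> (T -` B \<inter> space \<mu>) = emeasure \<mu> B)"
proof
  assume "distr \<mu> \<mu> T = \<mu>"
  then show "\<forall>B\<in>sets \<mu>. emeasure \<mu> (T -` B \<inter> space \<mu>) = emeasure \<mu> B"
    by (simp flip: emeasure_distr[OF assms])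
qed (intro measure_eqI; simp add: emeasure_distr[OF assms])

theorem uniquely_ergodicI:
  assumes compact: "compact_space (subtopology \<T> Y)"
    and T: "T ` Y \<subseteq> Y" and "Y \<noteq> {}"
    and "Sigma_Algebra.algebra Y \<A>"
    and borel: "sets (borel_measurable_space (subtopology \<T> Y)) = sigma_sets Y \<A>"
    and closed: "\<And>C. C \<in> \<A> \<Longrightarrow> closedin (subtopology \<T> Y) C"
    and vimage: "\<And>C. C \<in> \<A> \<Longrightarrow> T -` C \<inter> Y \<in> \<A>"
    and lim: "\<And>C. C \<in> \<A> \<Longrightarrow> \<exists>c. \<forall>y\<in>Y. (\<lambda>N. birkhoff_average T (indicator C) N y) \<longlonglongrightarrow> c"
  shows "uniquely_ergodic \<T> T Y"
proof -
  interpret Sigma_Algebra.algebra Y \<A> by fact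
  have invariant_iff: "invariant_borel_probability (subtopology \<T> Y) T \<mu> \<longleftrightarrow>
      prob_space \<mu> \<and> sets \<mu> = sigma_sets Y \<A> \<and> distr \<mu> \<mu> T = \<mu>" for \<mu>
  proof (cases "sets \<mu> = sigma_sets Y \<A>")
    case True
    then show ?thesis
      using distr_eq_self_iff[OF measurable_generator[OF True T vimage]]
      by (simp add: invariant_borel_probability_def borel)
  qed (simp add: invariant_borel_probability_def borel)
  have nest: "\<exists>i. A i = {}" if "range A \<subseteq> \<A>" "decseq A" "(\<Inter>i. A i) = {}" for A :: "nat \<Rightarrow> _"
  proof (rule ccontr)
    assume "\<not> (\<exists>i. A i = {})"
    then have "(\<Inter>i. A i) \<noteq> {}"
      using that(1,2) closed by (intro compact_space_imp_nest[OF compact]) auto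
    then show False using that(3) by contradiction
  qed
  show ?thesis
    unfolding uniquely_ergodic_def invariant_iff
    using T vimage nest \<open>Y \<noteq> {}\<close> lim by (rule ex1_invariant_prob_space)
qed

section \<open>Powers of substitutions\<close>

definition letter_positive :: "('a list \<Rightarrow> 'a list) \<Rightarrow> bool" where
  "letter_positive \<sigma> \<longleftrightarrow> (\<forall>a b. b \<in> set (\<sigma> [a]))"

lemma letter_positiveD: "letter_positive \<sigma> \<Longrightarrow> b \<in> set (\<sigma> [a])"
  by (simp add: letter_positive_def)

lemma letter_positive_funpow:
  assumes "substitution \<sigma>" "letter_positive \<sigma>" "n \<ge> 1"
  shows "letter_positive (\<sigma> ^^ n)"
  using assms(3)
proof (induction n rule: nat_induct_at_least)
  case (Suc n)
  show ?case
    unfolding letter_positive_def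
  proof (intro allI)
    fix a b
    have "a \<in> set ((\<sigma> ^^ n) [a])" using Suc.IH by (rule letter_positiveD)
    then show "b \<in> set ((\<sigma> ^^ Suc n) [a])"
      using letter_positiveD[OF assms(2)] set_substitution[OF assms(1), of "(\<sigma> ^^ n) [a]"] by auto
  qed
qed (simp add: assms(2))

lemma primitive_iff_letter_positive: "primitive \<sigma> \<longleftrightarrow> (\<exists>n\<ge>1. letter_positive (\<sigma> ^^ n))"
  by (simp add: primitive_def letter_positive_def)

lemma funpow_diff_apply: "k \<le> n \<Longrightarrow> (f ^^ k) ((f ^^ (n - k)) x) = (f ^^ n) x"
  by (metis comp_apply funpow_add le_add_diff_inverse)

lemma primitive_letter_preimage:
  assumes "substitution \<sigma>" "primitive \<sigma>"
  shows "\<exists>b. a \<in> set ((\<sigma> ^^ r) [b])"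
proof (cases "r = 0")
  case False
  obtain m where m: "m \<ge> 1" "letter_positive (\<sigma> ^^ m)"
    using assms(2) by (auto simp: primitive_iff_letter_positive)
  have "letter_positive ((\<sigma> ^^ m) ^^ r)"
    by (rule letter_positive_funpow[OF substitution_funpow[OF assms(1)] m(2)]) (use False in simp)
  then have "a \<in> set ((\<sigma> ^^ (m * r)) [a])" unfolding funpow_mult by (rule letter_positiveD)
  also have "(\<sigma> ^^ (m * r)) [a] = (\<sigma> ^^ r) ((\<sigma> ^^ (m * r - r)) [a])"
    by (rule funpow_diff_apply[symmetric]) (use m(1) in simp)
  also have "set \<dots> = (\<Union>b\<in>set ((\<sigma> ^^ (m * r - r)) [a]). set ((\<sigma> ^^ r) [b]))"
    by (rule set_substitution[OF substitution_funpow[OF assms(1)]])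
  finally show ?thesis by blast
qed (auto intro: exI[of _ a])

lemma shift_space_funpow:
  assumes "substitution \<sigma>" "primitive \<sigma>" "n \<ge> 1"
  shows "shift_space (\<sigma> ^^ n) = shift_space \<sigma>"
proof -
  have "(\<exists>k a. sublist w (((\<sigma> ^^ n) ^^ k) [a])) \<longleftrightarrow> (\<exists>k a. sublist w ((\<sigma> ^^ k) [a]))" for w
  proof
    assume "\<exists>k a. sublist w (((\<sigma> ^^ n) ^^ k) [a])"
    then show "\<exists>k a. sublist w ((\<sigma> ^^ k) [a])" by (auto simp: funpow_mult)
  next
    assume "\<exists>k a. sublist w ((\<sigma> ^^ k) [a])"
    then obtain k a where w: "sublist w ((\<sigma> ^^ k) [a])" by blast
    obtain b where "a \<in> set ((\<sigma> ^^ (n * k - k)) [b])"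
      using primitive_letter_preimage[OF assms(1,2)] by blast
    then have "sublist ((\<sigma> ^^ k) [a]) ((\<sigma> ^^ k) ((\<sigma> ^^ (n * k - k)) [b]))"
      by (rule sublist_substitution_letter[OF substitution_funpow[OF assms(1)]])
    also have "(\<sigma> ^^ k) ((\<sigma> ^^ (n * k - k)) [b]) = ((\<sigma> ^^ n) ^^ k) [b]"
      unfolding funpow_mult by (rule funpow_diff_apply) (use assms(3) in simp)
    finally show "\<exists>k a. sublist w (((\<sigma> ^^ n) ^^ k) [a])"
      using sublist_order.order.trans[OF w] by blast
  qed
  then show ?thesis by (simp add: shift_space_def)
qed

definition window :: "(int \<Rightarrow> 'a) \<Rightarrow> nat \<Rightarrow> 'a list" where
  "window x N = map (\<lambda>i. x (int i)) [0..<N]"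

lemma window_Suc: "window x (Suc N) = x 0 # window (shift_map x) N"
  by (simp add: window_def shift_map_def upt_conv_Cons flip: map_Suc_upt del: upt_Suc)
    (simp add: add.commute)

lemma window_eq_map_upto: "window x N = map x [0..int N - 1]"
proof (rule nth_equalityI)
  show "window x N ! i = map x [0..int N - 1] ! i" if "i < length (window x N)" for i
    using that by (simp add: window_def nth_upto)
qed (simp add: window_def)

lemma window_shift_space:
  assumes "x \<in> shift_space \<sigma>"
  obtains n a where "sublist (window x N) ((\<sigma> ^^ n) [a])"
  using assms unfolding window_eq_map_upto shift_space_def by blast

lemma length_letter_positive_ge_2:
  assumes "letter_positive \<sigma>" "shift_space \<sigma> \<noteq> {}"
  shows "2 \<le> length (\<sigma> [a])"
proof (rule ccontr)
  assume "\<not> 2 \<le> length (\<sigma> [a])"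
  then obtain b where b: "\<sigma> [a] = [b]"
    using letter_positiveD[OF assms(1), of a a] by (cases "\<sigma> [a]") (auto simp: Suc_le_eq)
  have single: "c = b" for c using letter_positiveD[OF assms(1), of c a] b by simp
  have fixed: "(\<sigma> ^^ n) [c] = [b]" for n c
  proof (induction n)
    case (Suc n)
    then show ?case using b single[of a] by simp
  qed (use single in simp)
  obtain x where "x \<in> shift_space \<sigma>" using assms(2) by blast
  then obtain n c where "sublist (window x 2) ((\<sigma> ^^ n) [c])" by (rule window_shift_space)
  then have "length (window x 2) \<le> 1" unfolding fixed using sublist_length_le by fastforce
  then show False by (simp add: window_def)
qed

section \<open>Graphs on letters\<close>

definition letter_graph :: "('b list \<Rightarrow> 'b list) \<Rightarrow> 'b set \<Rightarrow> ('b \<times> 'b) set" where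
  "letter_graph \<theta> S = {(s, t). s \<in> S \<and> t \<in> set (\<theta> [s])}"

lemma letter_graph_subset: "(\<And>s. s \<in> S \<Longrightarrow> set (\<theta> [s]) \<subseteq> S) \<Longrightarrow> letter_graph \<theta> S \<subseteq> S \<times> S"
  by (auto simp: letter_graph_def)

lemma letter_graph_funpow:
  assumes "substitution \<theta>" and S: "\<And>s. s \<in> S \<Longrightarrow> set (\<theta> [s]) \<subseteq> S" and "n \<ge> 1"
  shows "letter_graph (\<theta> ^^ n) S = letter_graph \<theta> S ^^ n"
  using assms(3)
proof (induction n rule: nat_induct_at_least)
  case (Suc n)
  have "set ((\<theta> ^^ n) [s]) \<subseteq> S" if "s \<in> S" for s
  proof (induction n)
    case (Suc n)
    then show ?case using S by (auto simp: set_substitution[OF assms(1), of "(\<theta> ^^ n) [s]"])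
  qed (simp add: that)
  then have "letter_graph (\<theta> ^^ Suc n) S = letter_graph (\<theta> ^^ n) S O letter_graph \<theta> S"
    by (auto simp: letter_graph_def set_substitution[OF assms(1), of "(\<theta> ^^ n) [_]"] relcomp_unfold)
  then show ?case by (simp only: Suc.IH relpow.simps)
qed simp

lemma relpow_idempotent_power:
  fixes R :: "('b \<times> 'b) set"
  assumes "finite R"
  obtains q where "q \<ge> 1" "R ^^ q O R ^^ q = R ^^ q"
proof -
  have "R ^^ Suc n \<subseteq> Domain R \<times> Range R" for n
    using relpow_Suc_D2 by (fastforce elim: relpow_Suc_E)
  then have "range (\<lambda>n. R ^^ Suc n) \<subseteq> Pow (Domain R \<times> Range R)" by blast
  then have "finite (range (\<lambda>n. R ^^ Suc n))"
    by (rule finite_subset) (simp add: assms finite_Domain finite_Range)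
  then have "\<not> inj (\<lambda>n. R ^^ Suc n)" using finite_imageD by fastforce
  then obtain m n where mn: "m < n" "R ^^ Suc m = R ^^ Suc n"
    unfolding inj_def by (metis linorder_neqE_nat)
  define i where "i = Suc m"
  define d where "d = n - m"
  have i: "i \<ge> 1" and d: "d \<ge> 1" and ij: "R ^^ (i + d) = R ^^ i"
    using mn by (simp_all add: i_def d_def)
  have shift: "R ^^ (n + d) = R ^^ n" if "n \<ge> i" for n
  proof -
    have "R ^^ (n + d) = R ^^ (n - i) O R ^^ (i + d)" using that by (simp flip: relpow_add)
    then show ?thesis using that by (simp add: ij flip: relpow_add)
  qed
  have periodic: "R ^^ (n + k * d) = R ^^ n" if "n \<ge> i" for n k
  proof (induction k)
    case (Suc k)
    have "R ^^ (n + Suc k * d) = R ^^ ((n + k * d) + d)" by (simp add: ac_simps)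
    then show ?case using shift[of "n + k * d"] Suc that by simp
  qed simp
  show thesis
  proof
    show "i * d \<ge> 1" using i d by simp
    have "i \<le> i * d" using d by simp
    then show "R ^^ (i * d) O R ^^ (i * d) = R ^^ (i * d)"
      using periodic[of "i * d" i] by (simp flip: relpow_add)
  qed
qed

text \<open>A path \<open>s \<rightarrow> t \<rightarrow> x s\<close> with \<open>x\<close> in \<open>G\<close> can be translated and iterated to
  \<open>s \<rightarrow> t \<rightarrow> x s \<rightarrow> x\<^sup>2 s \<rightarrow> \<dots>\<close>, which comes back to \<open>s\<close> because \<open>G\<close> is finite.\<close>

lemma (in group) equiv_translation_invariant:
  fixes R :: "(('a \<times> 'c) \<times> ('a \<times> 'c)) set"
  assumes "finite (carrier G)" and R: "R \<subseteq> (carrier G \<times> UNIV) \<times> (carrier G \<times> UNIV)" and "trans R"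
    and translate: "\<And>g h a b k. ((g, a), (h, b)) \<in> R \<Longrightarrow> k \<in> carrier G \<Longrightarrow>
      ((k \<otimes> g, a), (k \<otimes> h, b)) \<in> R"
    and reach: "\<And>g a b. g \<in> carrier G \<Longrightarrow> \<exists>h. ((g, a), (h, b)) \<in> R"
  shows "equiv (carrier G \<times> UNIV) R"
proof (rule equivI)
  show "sym R"
  proof (rule symI)
    fix s t assume st: "(s, t) \<in> R"
    obtain g a where s: "s = (g, a)" by (cases s)
    have g: "g \<in> carrier G" and t: "t \<in> carrier G \<times> UNIV" using st R s by auto
    then obtain g' where g': "(t, (g', a)) \<in> R" using reach by fastforce
    then have g'_closed: "g' \<in> carrier G" using R by auto
    define x where "x = g' \<otimes> inv g"
    have x: "x \<in> carrier G" "x \<otimes> g = g'"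
      using g g'_closed by (simp_all add: x_def m_assoc)
    have loop: "((g, a), (x \<otimes> g, a)) \<in> R" using transD[OF \<open>trans R\<close> st g'] s x by simp
    have "(t, (x [^] Suc n \<otimes> g, a)) \<in> R" for n :: nat
    proof (induction n)
      case 0
      then show ?case using g' x by simp
    next
      case (Suc n)
      have "((x [^] Suc n \<otimes> g, a), (x [^] Suc n \<otimes> (x \<otimes> g), a)) \<in> R"
        using translate[OF loop] x by simp
      then show ?case using transD[OF \<open>trans R\<close> Suc] x(1) g by (simp add: m_assoc)
    qed
    moreover have "x [^] Suc (order G - 1) = \<one>"
      using pow_order_eq_1[OF x(1)] order_gt_0_iff_finite assms(1) by simp
    ultimately have "(t, (\<one> \<otimes> g, a)) \<in> R" by metis
    then show "(t, s) \<in> R" using g s by simp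
  qed
  show "refl_on (carrier G \<times> UNIV) R"
  proof (rule refl_onI)
    fix s assume "s \<in> carrier G \<times> (UNIV :: 'c set)"
    then obtain t where "(s, t) \<in> R" using reach by (metis mem_Sigma_iff surj_pair)
    then show "(s, s) \<in> R" using \<open>sym R\<close> \<open>trans R\<close> by (meson symD transD)
  qed
qed fact+

section \<open>Itineraries\<close>

definition itinerary :: "('x \<Rightarrow> 'b) \<Rightarrow> ('x \<Rightarrow> 'x) \<Rightarrow> 'x \<Rightarrow> nat \<Rightarrow> 'b list" where
  "itinerary p T y N = map (\<lambda>i. p ((T ^^ i) y)) [0..<N]"

lemma length_itinerary [simp]: "length (itinerary p T y N) = N"
  by (simp add: itinerary_def)

lemma nth_itinerary [simp]: "i < N \<Longrightarrow> itinerary p T y N ! i = p ((T ^^ i) y)"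
  by (simp add: itinerary_def)

lemma itinerary_Suc: "itinerary p T y (Suc N) = p y # itinerary p T (T y) N"
  by (rule nth_equalityI) (auto simp: nth_Cons funpow_swap1 split: nat.split)

lemma take_drop_itinerary:
  assumes "i + L \<le> N"
  shows "take L (drop i (itinerary p T y N)) = itinerary p T ((T ^^ i) y) L"
  by (rule nth_equalityI) (use assms in \<open>auto simp: add.commute[of i] funpow_add\<close>)

lemma sum_shift_diff:
  fixes f :: "nat \<Rightarrow> real"
  assumes "\<And>i. \<bar>f i\<bar> \<le> 1"
  shows "\<bar>(\<Sum>i<N. f i) - (\<Sum>i<N. f (i + n))\<bar> \<le> 2 * n"
proof (induction n)
  case (Suc n)
  have "(\<Sum>i<N. f (i + Suc n)) = (\<Sum>i<N. f (i + n)) + f (N + n) - f n"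
    using sum.lessThan_Suc_shift[of "\<lambda>i. f (i + n)" N] by simp
  then show ?case using Suc assms[of n] assms[of "N + n"] by simp
qed simp

lemma tendsto_divide_bounded_diff:
  fixes f g :: "nat \<Rightarrow> real"
  assumes "(\<lambda>n. f n / n) \<longlonglongrightarrow> c" and "\<And>n. \<bar>g n - f n\<bar> \<le> K"
  shows "(\<lambda>n. g n / n) \<longlonglongrightarrow> c"
proof -
  have "(\<lambda>n. (g n - f n) / n) \<longlonglongrightarrow> 0"
  proof (rule Lim_null_comparison)
    show "\<forall>\<^sub>F n in sequentially. norm ((g n - f n) / n) \<le> K / n"
      using assms(2) by (intro always_eventually allI) (simp add: divide_right_mono)
    show "(\<lambda>n. K / n) \<longlonglongrightarrow> 0" by (rule lim_const_over_n)
  qed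
  from tendsto_add[OF this assms(1)] show ?thesis by (simp add: diff_divide_distrib)
qed

lemma birkhoff_average_tendsto_frequency:
  assumes code: "\<And>i. (T ^^ n) ((T ^^ i) y) \<in> B \<longleftrightarrow> itinerary p T ((T ^^ i) y) L \<in> P"
    and W: "\<And>N. itinerary p T y N \<in> W"
    and freq: "((\<lambda>w. block_sum L (indicator P) w / length w) \<longlongrightarrow> c) (long_words W)"
  shows "(\<lambda>N. birkhoff_average T (indicator B) N y) \<longlonglongrightarrow> c"
proof -
  define f where "f i = indicat_real B ((T ^^ i) y)" for i
  define b where "b i = indicat_real P (itinerary p T ((T ^^ i) y) L)" for i
  have shift: "f (i + n) = b i" for i
    using code[of i] by (simp add: f_def b_def indicator_def funpow_add add.commute[of i])
  have "(\<lambda>N. block_sum L (indicator P) (itinerary p T y N) / N) \<longlonglongrightarrow> c"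
    using filterlim_compose[OF freq filterlim_long_words[of "itinerary p T y", OF W]] by simp
  moreover have "\<bar>(\<Sum>i<N. f i) - block_sum L (indicator P) (itinerary p T y N)\<bar>
      \<le> 2 * n + 2 * L" for N
  proof -
    have "\<bar>(\<Sum>i<N. f i) - (\<Sum>i<N. b i)\<bar> \<le> 2 * n"
      using sum_shift_diff[of f N n] by (simp add: shift) (simp add: f_def indicator_def)
    moreover have "\<bar>(\<Sum>i<N. b i) - block_sum L (indicator P) (itinerary p T y N)\<bar> \<le> 2 * L"
      unfolding block_sum_def length_itinerary
      by (rule sum_diff_le_tail) (simp_all add: b_def indicator_def take_drop_itinerary)
    ultimately show ?thesis by linarith
  qed
  ultimately have "(\<lambda>N. (\<Sum>i<N. f i) / N) \<longlonglongrightarrow> c" by (rule tendsto_divide_bounded_diff)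
  then show ?thesis by (simp add: birkhoff_average_def f_def)
qed

section \<open>Cylinders in the skew product\<close>

definition agree :: "nat \<Rightarrow> (int \<Rightarrow> 'a) \<Rightarrow> (int \<Rightarrow> 'a) \<Rightarrow> bool" where
  "agree n x x' \<longleftrightarrow> (\<forall>i. \<bar>i\<bar> \<le> int n \<longrightarrow> x i = x' i)"

definition skew_agree :: "nat \<Rightarrow> 'g \<times> (int \<Rightarrow> 'a) \<Rightarrow> 'g \<times> (int \<Rightarrow> 'a) \<Rightarrow> bool" where
  "skew_agree n y y' \<longleftrightarrow> fst y = fst y' \<and> agree n (snd y) (snd y')"

lemma skew_agree_refl [simp]: "skew_agree n y y"
  and skew_agree_sym: "skew_agree n y y' \<Longrightarrow> skew_agree n y' y"
  and skew_agree_trans: "skew_agree n y y' \<Longrightarrow> skew_agree n y' z \<Longrightarrow> skew_agree n y z"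
  and skew_agree_mono: "skew_agree m y y' \<Longrightarrow> n \<le> m \<Longrightarrow> skew_agree n y y'"
  by (auto simp: skew_agree_def agree_def)

lemma skew_agree_skew_map:
  "skew_agree (Suc n) y y' \<Longrightarrow> skew_agree n (skew_map G \<phi> y) (skew_map G \<phi> y')"
  by (auto simp: skew_agree_def agree_def skew_map_def shift_map_def split: prod.splits)

lemma topspace_full_shift [simp]: "topspace full_shift_topology = UNIV"
  by (simp add: full_shift_topology_def)

lemma topspace_skew_topology: "topspace (skew_topology G X) = carrier G \<times> X"
  by (simp add: skew_topology_def)

lemma openin_full_shift_agree: "openin full_shift_topology {x'. agree n x x'}"
proof -
  define U where "U i = (if \<bar>i\<bar> \<le> int n then {x i} else UNIV)" for i
  have "finite {i. U i \<noteq> UNIV}"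
    by (rule finite_subset[of _ "{- int n..int n}"]) (auto simp: U_def)
  moreover have "{x'. agree n x x'} = Pi\<^sub>E UNIV U" by (auto simp: agree_def U_def PiE_def Pi_def)
  ultimately show ?thesis by (simp add: full_shift_topology_def openin_PiE_gen)
qed

lemma openin_full_shift_imp_agree:
  assumes "openin full_shift_topology V" "x \<in> V"
  shows "\<exists>n. {x'. agree n x x'} \<subseteq> V"
proof -
  obtain U where U: "finite {i. U i \<noteq> UNIV}" "x \<in> Pi\<^sub>E UNIV U" "Pi\<^sub>E UNIV U \<subseteq> V"
    using assms unfolding full_shift_topology_def openin_product_topology_alt by auto
  define n where "n = Max (insert 0 ((\<lambda>i. nat \<bar>i\<bar>) ` {i. U i \<noteq> UNIV}))"
  have n: "\<bar>i\<bar> \<le> int n" if "U i \<noteq> UNIV" for i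
  proof -
    have "nat \<bar>i\<bar> \<le> n" unfolding n_def using U(1) that by (intro Max_ge) auto
    then show ?thesis by linarith
  qed
  have "x' i \<in> U i" if "agree n x x'" for x' i
    using n[of i] that PiE_mem[OF U(2), of i] by (cases "U i = UNIV") (simp_all add: agree_def)
  then have "{x'. agree n x x'} \<subseteq> Pi\<^sub>E UNIV U" by auto
  then show ?thesis using U(3) by blast
qed

lemma openin_full_shift:
  "openin full_shift_topology V \<longleftrightarrow> (\<forall>x\<in>V. \<exists>n. {x'. agree n x x'} \<subseteq> V)" (is "?L \<longleftrightarrow> ?R")
proof
  assume ?R
  moreover have "x \<in> {x'. agree n x x'}" for x :: "int \<Rightarrow> 'a" and n by (simp add: agree_def)
  ultimately show ?L by (subst openin_subopen) (meson openin_full_shift_agree)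
qed (use openin_full_shift_imp_agree in blast)

lemma closedin_shift_space: "closedin full_shift_topology (shift_space \<sigma>)"
proof -
  have "openin full_shift_topology (- shift_space \<sigma>)"
    unfolding openin_full_shift
  proof
    fix x assume "x \<in> - shift_space \<sigma>"
    then obtain i j where ij: "\<And>n a. \<not> sublist (map x [i..j]) ((\<sigma> ^^ n) [a])"
      by (auto simp: shift_space_def)
    have "x' \<in> - shift_space \<sigma>" if "agree (nat (\<bar>i\<bar> + \<bar>j\<bar>)) x x'" for x'
    proof -
      have eq: "map x' [i..j] = map x [i..j]"
        using that unfolding agree_def by (intro map_cong) auto
      have "\<not> sublist (map x' [i..j]) ((\<sigma> ^^ n) [a])" for n a unfolding eq by (rule ij)
      then show ?thesis unfolding shift_space_def by blast
    qed
    then show "\<exists>n. {x'. agree n x x'} \<subseteq> - shift_space \<sigma>" by blast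
  qed
  then show ?thesis by (simp add: closedin_def Compl_eq_Diff_UNIV)
qed

lemma compact_space_skew_topology:
  fixes X :: "(int \<Rightarrow> 'a::finite) set"
  assumes "finite (carrier G)" "closedin full_shift_topology X"
  shows "compact_space (skew_topology G X)"
proof -
  have "compact_space (full_shift_topology :: (int \<Rightarrow> 'a) topology)"
    by (simp add: full_shift_topology_def compact_space_product_topology
        compact_space_discrete_topology)
  then have "compact_space (subtopology full_shift_topology X)"
    using assms(2) closedin_compact_space compact_space_subtopology by blast
  then show ?thesis
    using assms(1)
    by (simp add: skew_topology_def compact_space_prod_topology compact_space_discrete_topology)
qed

lemma openin_skew_agree:
  assumes "y \<in> carrier G \<times> X"
  shows "openin (skew_topology G X) {y' \<in> carrier G \<times> X. skew_agree n y y'}"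
proof -
  have "{y' \<in> carrier G \<times> X. skew_agree n y y'} = {fst y} \<times> ({x'. agree n (snd y) x'} \<inter> X)"
    using assms by (auto simp: skew_agree_def)
  moreover have "openin (subtopology full_shift_topology X) ({x'. agree n (snd y) x'} \<inter> X)"
    by (rule openin_subtopology_Int[OF openin_full_shift_agree])
  ultimately show ?thesis
    using assms by (auto simp: skew_topology_def openin_prod_Times_iff)
qed

lemma openin_skew_imp_agree:
  assumes "openin (skew_topology G X) U" "y \<in> U"
  shows "\<exists>n. {y' \<in> carrier G \<times> X. skew_agree n y y'} \<subseteq> U"
proof -
  obtain A B where AB: "openin (subtopology full_shift_topology X) B"
    "fst y \<in> A" "snd y \<in> B" "A \<times> B \<subseteq> U"
    using assms unfolding skew_topology_def openin_prod_topology_alt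
    by (metis prod.collapse)
  then obtain V where V: "openin full_shift_topology V" "B = V \<inter> X"
    unfolding openin_subtopology by blast
  then obtain n where "{x'. agree n (snd y) x'} \<subseteq> V" using openin_full_shift AB(3) by blast
  then have "{y' \<in> carrier G \<times> X. skew_agree n y y'} \<subseteq> A \<times> B"
    using AB(2) V(2) by (auto simp: skew_agree_def)
  then show ?thesis using AB(4) by blast
qed

lemma openin_skew_subtopology:
  assumes Y: "Y \<subseteq> carrier G \<times> X"
  shows "openin (subtopology (skew_topology G X) Y) U \<longleftrightarrow>
    U \<subseteq> Y \<and> (\<forall>y\<in>U. \<exists>n. {y' \<in> Y. skew_agree n y y'} \<subseteq> U)" (is "?L \<longleftrightarrow> ?R")
proof
  assume ?L
  then obtain W where W: "openin (skew_topology G X) W" "U = W \<inter> Y"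
    unfolding openin_subtopology by blast
  have "\<exists>n. {y' \<in> Y. skew_agree n y y'} \<subseteq> U" if "y \<in> U" for y
    using openin_skew_imp_agree[OF W(1), of y] that W(2) Y by blast
  then show ?R using W(2) by blast
next
  assume R: ?R
  show ?L
    unfolding openin_subopen[of _ U]
  proof
    fix y assume y: "y \<in> U"
    then obtain n where n: "{y' \<in> Y. skew_agree n y y'} \<subseteq> U" using R by blast
    have "{y' \<in> Y. skew_agree n y y'} = {y' \<in> carrier G \<times> X. skew_agree n y y'} \<inter> Y"
      using Y by blast
    moreover have "openin (skew_topology G X) {y' \<in> carrier G \<times> X. skew_agree n y y'}"
      by (rule openin_skew_agree) (use y R Y in blast)
    ultimately have "openin (subtopology (skew_topology G X) Y) {y' \<in> Y. skew_agree n y y'}"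
      by (simp only: openin_subtopology_Int)
    moreover have "y \<in> {y' \<in> Y. skew_agree n y y'}" using y R by auto
    ultimately show "\<exists>V. openin (subtopology (skew_topology G X) Y) V \<and> y \<in> V \<and> V \<subseteq> U"
      using n by blast
  qed
qed

definition cylinders :: "('g \<times> (int \<Rightarrow> 'a)) set \<Rightarrow> ('g \<times> (int \<Rightarrow> 'a)) set set" where
  "cylinders Y = {C. C \<subseteq> Y \<and> (\<exists>n. \<forall>y\<in>C. \<forall>y'\<in>Y. skew_agree n y y' \<longrightarrow> y' \<in> C)}"

lemma cylindersI:
  fixes n :: nat
  shows "C \<subseteq> Y \<Longrightarrow> (\<And>y y'. y \<in> C \<Longrightarrow> y' \<in> Y \<Longrightarrow> skew_agree n y y' \<Longrightarrow> y' \<in> C) \<Longrightarrow> C \<in> cylinders Y"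
  unfolding cylinders_def by blast

lemma cylindersD:
  "C \<in> cylinders Y \<Longrightarrow> \<exists>n. \<forall>y\<in>C. \<forall>y'\<in>Y. skew_agree n y y' \<longrightarrow> y' \<in> C"
  unfolding cylinders_def by blast

lemma cylinders_subset: "C \<in> cylinders Y \<Longrightarrow> C \<subseteq> Y"
  unfolding cylinders_def by blast

lemma algebra_cylinders: "Sigma_Algebra.algebra Y (cylinders Y)"
  unfolding algebra_iff_Un
proof (intro conjI ballI)
  show "cylinders Y \<subseteq> Pow Y" "{} \<in> cylinders Y" by (auto simp: cylinders_def)
  show "Y - C \<in> cylinders Y" if C: "C \<in> cylinders Y" for C
  proof -
    obtain n where n: "\<forall>y\<in>C. \<forall>y'\<in>Y. skew_agree n y y' \<longrightarrow> y' \<in> C"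
      using cylindersD[OF C] by blast
    show ?thesis by (rule cylindersI[of _ _ n]) (use n skew_agree_sym in blast)+
  qed
  show "C \<union> D \<in> cylinders Y" if C: "C \<in> cylinders Y" and D: "D \<in> cylinders Y" for C D
  proof -
    obtain n where n: "\<forall>y\<in>C. \<forall>y'\<in>Y. skew_agree n y y' \<longrightarrow> y' \<in> C"
      using cylindersD[OF C] by blast
    obtain m where m: "\<forall>y\<in>D. \<forall>y'\<in>Y. skew_agree m y y' \<longrightarrow> y' \<in> D"
      using cylindersD[OF D] by blast
    show ?thesis
    proof (rule cylindersI[of _ _ "max n m"])
      show "C \<union> D \<subseteq> Y" using C D cylinders_subset by blast
      fix y y' assume "y \<in> C \<union> D" "y' \<in> Y" and agree: "skew_agree (max n m) y y'"
      then show "y' \<in> C \<union> D"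
        using n m skew_agree_mono[OF agree, of n] skew_agree_mono[OF agree, of m] by auto
    qed
  qed
qed

lemma openin_cylinder:
  assumes "Y \<subseteq> carrier G \<times> X" "C \<in> cylinders Y"
  shows "openin (subtopology (skew_topology G X) Y) C"
  using assms(2) unfolding openin_skew_subtopology[OF assms(1)] cylinders_def by blast

lemma closedin_cylinder:
  assumes "Y \<subseteq> carrier G \<times> X" "C \<in> cylinders Y"
  shows "closedin (subtopology (skew_topology G X) Y) C"
proof -
  interpret Sigma_Algebra.algebra Y "cylinders Y" by (rule algebra_cylinders)
  have "topspace (subtopology (skew_topology G X) Y) = Y"
    using assms(1) by (auto simp: topspace_skew_topology)
  moreover have "C \<subseteq> Y" using assms(2) by (rule cylinders_subset)
  moreover have "Y - C \<in> cylinders Y" using assms(2) by (rule compl_sets)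
  ultimately show ?thesis using openin_cylinder[OF assms(1)] by (simp add: closedin_def)
qed

lemma sets_borel_skew_subtopology:
  assumes "Y \<subseteq> carrier G \<times> X"
  shows "sets (borel_measurable_space (subtopology (skew_topology G X) Y))
    = sigma_sets Y (cylinders Y)"
proof -
  let ?T = "subtopology (skew_topology G X) Y"
  have "topspace ?T = Y" using assms by (auto simp: topspace_skew_topology)
  then have "sets (borel_measurable_space ?T) = sigma_sets Y {U. openin ?T U}"
    unfolding borel_measurable_space_def using openin_subset[of ?T] by (subst sets_measure_of) auto
  also have "\<dots> = sigma_sets Y (cylinders Y)"
  proof (rule sigma_sets_eqI)
    fix U assume "U \<in> {U. openin ?T U}"
    then have U: "U \<subseteq> Y" "\<And>y. y \<in> U \<Longrightarrow> \<exists>n. {y' \<in> Y. skew_agree n y y'} \<subseteq> U"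
      by (auto simp: openin_skew_subtopology[OF assms])
    define D where "D n = {y \<in> Y. {y' \<in> Y. skew_agree n y y'} \<subseteq> U}" for n
    have "D n \<in> cylinders Y" for n
      by (rule cylindersI[of _ _ n]) (auto simp: D_def intro: skew_agree_trans)
    moreover have "U = (\<Union>n. D n)"
    proof
      show "U \<subseteq> (\<Union>n. D n)" using U by (fastforce simp: D_def)
      show "(\<Union>n. D n) \<subseteq> U" by (auto simp: D_def)
    qed
    ultimately show "U \<in> sigma_sets Y (cylinders Y)" by (auto intro: sigma_sets.Union)
  qed (use openin_cylinder[OF assms] in auto)
  finally show ?thesis .
qed

lemma cylinder_vimage_skew_map:
  assumes T: "skew_map G \<phi> ` Y \<subseteq> Y" and C: "C \<in> cylinders Y"
  shows "skew_map G \<phi> -` C \<inter> Y \<in> cylinders Y"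
proof -
  obtain n where n: "\<forall>y\<in>C. \<forall>y'\<in>Y. skew_agree n y y' \<longrightarrow> y' \<in> C"
    using cylindersD[OF C] by blast
  show ?thesis
  proof (rule cylindersI[of _ _ "Suc n"])
    fix y y' assume y: "y \<in> skew_map G \<phi> -` C \<inter> Y" "y' \<in> Y" "skew_agree (Suc n) y y'"
    have "skew_agree n (skew_map G \<phi> y) (skew_map G \<phi> y')" using y(3) by (rule skew_agree_skew_map)
    then show "y' \<in> skew_map G \<phi> -` C \<inter> Y" using n y T by blast
  qed simp
qed

definition state :: "'g \<times> (int \<Rightarrow> 'a) \<Rightarrow> 'g \<times> 'a" where
  "state y = (fst y, snd y 0)"

lemma snd_funpow_skew_map: "snd ((skew_map G \<phi> ^^ n) y) = (\<lambda>i. snd y (i + int n))"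
  by (induction n) (auto simp: skew_map_def shift_map_def ac_simps split: prod.splits)

lemma itinerary_eq_imp_skew_agree:
  assumes "itinerary state (skew_map G \<phi>) y (2 * n + 1)
    = itinerary state (skew_map G \<phi>) y' (2 * n + 1)"
  shows "skew_agree n ((skew_map G \<phi> ^^ n) y) ((skew_map G \<phi> ^^ n) y')"
proof -
  let ?T = "skew_map G \<phi>"
  have state: "state ((?T ^^ i) y) = state ((?T ^^ i) y')" if "i \<le> 2 * n" for i
    using arg_cong[OF assms, of "\<lambda>w. w ! i"] that by simp
  have "snd y (i + int n) = snd y' (i + int n)" if "\<bar>i\<bar> \<le> int n" for i
  proof -
    have "nat (i + int n) \<le> 2 * n" "0 \<le> i + int n" using that by linarith+
    then show ?thesis using state[of "nat (i + int n)"] by (simp add: state_def snd_funpow_skew_map)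
  qed
  moreover have "fst ((?T ^^ n) y) = fst ((?T ^^ n) y')" using state[of n] by (simp add: state_def)
  ultimately show ?thesis by (simp add: skew_agree_def agree_def snd_funpow_skew_map)
qed

lemma cylinder_coded_by_itinerary:
  assumes T: "skew_map G \<phi> ` Y \<subseteq> Y" and C: "C \<in> cylinders Y"
  shows "\<exists>n L P. \<forall>y\<in>Y. (skew_map G \<phi> ^^ n) y \<in> C \<longleftrightarrow> itinerary state (skew_map G \<phi>) y L \<in> P"
proof -
  let ?T = "skew_map G \<phi>"
  obtain n where n: "\<forall>y\<in>C. \<forall>y'\<in>Y. skew_agree n y y' \<longrightarrow> y' \<in> C"
    using cylindersD[OF C] by blast
  define P where "P = {itinerary state ?T y (2 * n + 1) | y. y \<in> Y \<and> (?T ^^ n) y \<in> C}"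
  have "(?T ^^ n) y \<in> C" if y: "y \<in> Y" and yP: "itinerary state ?T y (2 * n + 1) \<in> P" for y
  proof -
    obtain y' where y': "(?T ^^ n) y' \<in> C"
      "itinerary state ?T y (2 * n + 1) = itinerary state ?T y' (2 * n + 1)"
      using yP unfolding P_def by blast
    show ?thesis
      using n y'(1) funpow_mem[OF T y] itinerary_eq_imp_skew_agree[OF y'(2)[symmetric]] by blast
  qed
  then have "\<forall>y\<in>Y. (?T ^^ n) y \<in> C \<longleftrightarrow> itinerary state ?T y (2 * n + 1) \<in> P"
    by (auto simp: P_def)
  then show ?thesis by blast
qed

section \<open>The lifted substitution\<close>

locale skew_substitution = group G for G :: "('g, 'k) monoid_scheme" (structure) +
  fixes \<phi> :: "'a list \<Rightarrow> 'g" and \<tau> :: "'a list \<Rightarrow> 'a list"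
  assumes phi: "monoid_morphism free_monoid G \<phi>"
    and substitution: "substitution \<tau>"
    and phi_tau: "\<phi> \<circ> \<tau> = \<phi>"
begin

lemma phi_closed [simp]: "\<phi> u \<in> carrier G"
  and phi_append: "\<phi> (u @ v) = \<phi> u \<otimes> \<phi> v"
  and phi_Nil [simp]: "\<phi> [] = \<one>"
  using phi by (auto simp: monoid_morphism_def free_monoid_def hom_def)

lemma phi_Cons: "\<phi> (a # u) = \<phi> [a] \<otimes> \<phi> u"
  using phi_append[of "[a]" u] by simp

primrec lift :: "'g \<Rightarrow> 'a list \<Rightarrow> ('g \<times> 'a) list" where
  "lift g [] = []"
| "lift g (a # u) = (g, a) # lift (g \<otimes> \<phi> [a]) u"

lemma map_snd_lift: "map snd (lift g u) = u"
  by (induction u arbitrary: g) simp_all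

lemma length_lift: "length (lift g u) = length u"
  by (metis length_map map_snd_lift)

lemma set_lift: "g \<in> carrier G \<Longrightarrow> set (lift g u) \<subseteq> carrier G \<times> UNIV"
  by (induction u arbitrary: g) auto

lemma lift_append:
  "g \<in> carrier G \<Longrightarrow> lift g (u @ v) = lift g u @ lift (g \<otimes> \<phi> u) v"
  by (induction u arbitrary: g) (simp_all add: m_assoc phi_Cons[of _ "_ # _"] flip: phi_Cons)

lemma lift_translate:
  assumes "k \<in> carrier G" "g \<in> carrier G"
  shows "lift (k \<otimes> g) u = map (apfst ((\<otimes>) k)) (lift g u)"
  using assms(2)
proof (induction u arbitrary: g)
  case (Cons a u)
  then show ?case using Cons.IH[of "g \<otimes> \<phi> [a]"] assms(1) by (simp add: m_assoc)
qed simp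

lemma sublist_lift:
  assumes "sublist u v" "g \<in> carrier G"
  shows "\<exists>h\<in>carrier G. sublist (lift g u) (lift h v)"
proof -
  obtain s t where v: "v = s @ u @ t" using assms(1) by (auto simp: sublist_def)
  define h where "h = g \<otimes> inv (\<phi> s)"
  have h: "h \<in> carrier G" "h \<otimes> \<phi> s = g" using assms(2) by (simp_all add: h_def m_assoc)
  then have "lift h v = lift h s @ lift g u @ lift (g \<otimes> \<phi> u) t"
    using assms(2) by (simp add: v lift_append)
  then show ?thesis using h(1) by (intro bexI[of _ h]) simp_all
qed

definition lift_substitution :: "('g \<times> 'a) list \<Rightarrow> ('g \<times> 'a) list" where
  "lift_substitution w = concat (map (\<lambda>(g, a). lift g (\<tau> [a])) w)"

lemma substitution_lift_substitution: "substitution lift_substitution"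
  by (rule substitutionI) (simp_all add: lift_substitution_def)

lemma lift_substitution_lift:
  "g \<in> carrier G \<Longrightarrow> lift_substitution (lift g u) = lift g (\<tau> u)"
proof (induction u arbitrary: g)
  case Nil
  then show ?case by (simp add: lift_substitution_def substitution_Nil[OF substitution])
next
  case (Cons a u)
  have "lift_substitution (lift g (a # u)) = lift g (\<tau> [a]) @ lift (g \<otimes> \<phi> [a]) (\<tau> u)"
    using Cons by (simp add: lift_substitution_def)
  also have "\<dots> = lift g (\<tau> [a] @ \<tau> u)"
    using Cons.prems fun_cong[OF phi_tau, of "[a]"] by (simp add: lift_append)
  also have "\<tau> [a] @ \<tau> u = \<tau> (a # u)" using substitution_append[OF substitution, of "[a]" u] by simp
  finally show ?case .
qed

lemma funpow_lift_substitution_lift: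
  "g \<in> carrier G \<Longrightarrow> (lift_substitution ^^ n) (lift g u) = lift g ((\<tau> ^^ n) u)"
  by (induction n) (simp_all add: lift_substitution_lift)

lemma funpow_lift_substitution_letter:
  "g \<in> carrier G \<Longrightarrow> (lift_substitution ^^ n) [(g, a)] = lift g ((\<tau> ^^ n) [a])"
  using funpow_lift_substitution_lift[of g n "[a]"] by simp

lemma set_funpow_lift_substitution_letter:
  "s \<in> carrier G \<times> UNIV \<Longrightarrow> set ((lift_substitution ^^ n) [s]) \<subseteq> carrier G \<times> UNIV"
  by (cases s) (auto simp: funpow_lift_substitution_letter dest: subsetD[OF set_lift])

definition state_graph :: "nat \<Rightarrow> (('g \<times> 'a) \<times> ('g \<times> 'a)) set" where
  "state_graph n = letter_graph (lift_substitution ^^ n) (carrier G \<times> UNIV)"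

lemma state_graph_subset: "state_graph n \<subseteq> (carrier G \<times> UNIV) \<times> (carrier G \<times> UNIV)"
  unfolding state_graph_def by (rule letter_graph_subset) (rule set_funpow_lift_substitution_letter)

lemma mem_state_graph_iff:
  "((g, a), (h, b)) \<in> state_graph n \<longleftrightarrow> g \<in> carrier G \<and> (h, b) \<in> set (lift g ((\<tau> ^^ n) [a]))"
  by (auto simp: state_graph_def letter_graph_def funpow_lift_substitution_letter)

lemma state_graph_translate:
  assumes "((g, a), (h, b)) \<in> state_graph n" "k \<in> carrier G"
  shows "((k \<otimes> g, a), (k \<otimes> h, b)) \<in> state_graph n"
  using assms
  by (auto simp: mem_state_graph_iff lift_translate image_iff intro!: bexI[of _ "(h, b)"])

lemma state_graph_reaches_letter:
  assumes "letter_positive \<tau>" "g \<in> carrier G" "n \<ge> 1"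
  shows "\<exists>h. ((g, a), (h, b)) \<in> state_graph n"
proof -
  have "b \<in> set (map snd (lift g ((\<tau> ^^ n) [a])))"
    unfolding map_snd_lift
    using letter_positive_funpow[OF substitution assms(1,3)] by (rule letter_positiveD)
  then show ?thesis using assms(2) by (auto simp: mem_state_graph_iff)
qed

lemma ex_equiv_state_graph:
  assumes "finite (carrier G)" "finite (UNIV :: 'a set)" "letter_positive \<tau>"
  shows "\<exists>q\<ge>1. equiv (carrier G \<times> UNIV) (state_graph q)"
proof -
  have "finite ((carrier G \<times> (UNIV :: 'a set)) \<times> (carrier G \<times> (UNIV :: 'a set)))"
    using assms(1,2) by simp
  then have "finite (state_graph 1)" using state_graph_subset by (rule rev_finite_subset)
  then obtain q where q: "q \<ge> 1" "state_graph 1 ^^ q O state_graph 1 ^^ q = state_graph 1 ^^ q"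
    by (rule relpow_idempotent_power)
  have "state_graph q = state_graph 1 ^^ q"
    unfolding state_graph_def
    using letter_graph_funpow[OF substitution_lift_substitution _ q(1)]
      set_funpow_lift_substitution_letter[of _ 1] by simp
  then have "trans (state_graph q)" unfolding trans_def using q(2) by blast
  then have "equiv (carrier G \<times> UNIV) (state_graph q)"
    by (intro equiv_translation_invariant assms(1) state_graph_subset)
      (auto intro: state_graph_translate state_graph_reaches_letter[OF assms(3) _ q(1)])
  then show ?thesis using q(1) by blast
qed

end

section \<open>Minimal sets of the skew product\<close>

lemma minimal_skewD:
  assumes "minimal_closed_invariant (skew_topology G X) T Y"
  shows "T ` Y \<subseteq> Y" "closedin (skew_topology G X) Y" "Y \<noteq> {}" "Y \<subseteq> carrier G \<times> X"
  using assms closedin_subset[of "skew_topology G X" Y]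
  by (auto simp: minimal_closed_invariant_def closed_invariant_def topspace_skew_topology)

lemma minimal_closed_invariant_eqI:
  assumes "minimal_closed_invariant \<T> T Y" and "closedin \<T> Z" "T ` Z \<subseteq> Z" "Z \<noteq> {}" "Z \<subseteq> Y"
  shows "Z = Y"
  using assms unfolding minimal_closed_invariant_def closed_invariant_def by blast

locale equiv_skew_substitution = skew_substitution G \<phi> \<tau>
  for G :: "('g, 'k) monoid_scheme" (structure) and \<phi> :: "'a::finite list \<Rightarrow> 'g" and \<tau> +
  fixes q :: nat
  assumes finite_carrier: "finite (carrier G)"
    and positive: "letter_positive \<tau>"
    and shift_nonempty: "shift_space \<tau> \<noteq> {}"
    and q: "q \<ge> 1" and equiv_q: "equiv (carrier G \<times> UNIV) (state_graph q)"
begin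

lemma shift_space_funpow_q: "shift_space (\<tau> ^^ q) = shift_space \<tau>"
proof (rule shift_space_funpow[OF substitution _ q])
  show "primitive \<tau>"
    unfolding primitive_iff_letter_positive using positive by (intro exI[of _ 1]) simp
qed

abbreviation state_class :: "'g \<times> 'a \<Rightarrow> ('g \<times> 'a) set" where
  "state_class s \<equiv> state_graph q `` {s}"

lemma positive_substitution_class:
  assumes s: "s \<in> carrier G \<times> UNIV"
  shows "positive_substitution (lift_substitution ^^ q) (state_class s)"
proof
  show "substitution (lift_substitution ^^ q)"
    by (rule substitution_funpow[OF substitution_lift_substitution])
  have "finite ((carrier G \<times> UNIV) :: ('g \<times> 'a) set)" by (simp add: finite_carrier)
  then show "finite (state_class s)"
    by (rule rev_finite_subset) (use state_graph_subset in auto)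
  fix t assume t: "t \<in> state_class s"
  then have t_closed: "t \<in> carrier G \<times> UNIV" using state_graph_subset by auto
  then have "set ((lift_substitution ^^ q) [t]) = state_class t"
    by (auto simp: state_graph_def letter_graph_def)
  also have "\<dots> = state_class s" using equiv_class_eq[OF equiv_q] t by auto
  finally show "set ((lift_substitution ^^ q) [t]) = state_class s" .
  have "letter_positive (\<tau> ^^ q)" using substitution positive q by (rule letter_positive_funpow)
  then have "2 \<le> length ((\<tau> ^^ q) [snd t])"
    by (rule length_letter_positive_ge_2) (simp add: shift_space_funpow_q shift_nonempty)
  then show "2 \<le> length ((lift_substitution ^^ q) [t])"
    using t_closed by (cases t) (simp add: funpow_lift_substitution_letter length_lift)
qed

abbreviation class_language :: "'g \<times> 'a \<Rightarrow> ('g \<times> 'a) list set" where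
  "class_language s \<equiv> positive_substitution.language (lift_substitution ^^ q) (state_class s)"

lemma itinerary_eq_lift:
  "itinerary state (skew_map G \<phi>) (g, x) N = lift g (window x N)"
proof (induction N arbitrary: g x)
  case (Suc N)
  then show ?case by (simp add: itinerary_Suc window_Suc state_def skew_map_def)
qed (simp add: itinerary_def window_def)

lemma itinerary_in_class_language:
  assumes "y \<in> carrier G \<times> shift_space \<tau>"
  shows "itinerary state (skew_map G \<phi>) y N \<in> class_language (state y)"
proof -
  obtain g x where y: "y = (g, x)" "g \<in> carrier G" "x \<in> shift_space \<tau>" using assms by auto
  obtain n a where "sublist (window x (Suc N)) (((\<tau> ^^ q) ^^ n) [a])"
    using y(3) unfolding shift_space_funpow_q[symmetric] by (rule window_shift_space)
  then obtain h where h: "h \<in> carrier G"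
    "sublist (lift g (window x (Suc N))) (lift h (((\<tau> ^^ q) ^^ n) [a]))"
    using sublist_lift y(2) by blast
  interpret positive_substitution "lift_substitution ^^ q" "state_class (h, a)"
    using h(1) by (intro positive_substitution_class) simp
  have "(h, a) \<in> state_class (h, a)" using equiv_class_self[OF equiv_q] h(1) by simp
  moreover have "sublist (lift g (window x (Suc N))) (((lift_substitution ^^ q) ^^ n) [(h, a)])"
    using h by (simp add: funpow_mult funpow_lift_substitution_letter)
  ultimately have w: "itinerary state (skew_map G \<phi>) y (Suc N) \<in> language"
    unfolding language_def y(1) itinerary_eq_lift by blast
  have "state y \<in> set (itinerary state (skew_map G \<phi>) y (Suc N))" by (simp add: itinerary_Suc)
  then have "((h, a), state y) \<in> state_graph q" using set_language[OF w] by blast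
  moreover have "itinerary state (skew_map G \<phi>) y N \<in> language"
    using w by (rule language_sublist) (simp add: itinerary_def)
  ultimately show ?thesis using equiv_class_eq[OF equiv_q] by metis
qed

lemma state_skew_map_in_state_class:
  assumes "y \<in> carrier G \<times> shift_space \<tau>"
  shows "state (skew_map G \<phi> y) \<in> state_class (state y)"
proof -
  interpret positive_substitution "lift_substitution ^^ q" "state_class (state y)"
    using assms by (intro positive_substitution_class) (auto simp: state_def)
  have "set (itinerary state (skew_map G \<phi>) y 2) \<subseteq> state_class (state y)"
    by (intro set_language itinerary_in_class_language assms)
  then show ?thesis by (simp add: numeral_2_eq_2 itinerary_Suc)
qed

text \<open>The class of the state at the origin is locally constant and invariant, so its level sets
  are clopen and minimality applies.\<close>

lemma minimal_state_class:
  assumes min: "minimal_closed_invariant (skew_topology G (shift_space \<tau>)) (skew_map G \<phi>) Y"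
    and y: "y \<in> Y" and z: "z \<in> Y"
  shows "state_class (state z) = state_class (state y)"
proof -
  let ?\<T> = "skew_topology G (shift_space \<tau>)" and ?T = "skew_map G \<phi>"
  note inv = minimal_skewD(1)[OF min] and closed = minimal_skewD(2)[OF min]
    and Y = minimal_skewD(4)[OF min]
  define Z where "Z = {z \<in> Y. state_class (state z) = state_class (state y)}"
  have "Z \<in> cylinders Y"
    by (rule cylindersI[of _ _ 0]) (auto simp: Z_def state_def skew_agree_def agree_def)
  then have "closedin ?\<T> Z"
    using closedin_trans_full[OF closedin_cylinder[OF Y] closed] by blast
  moreover have "state_class (state (?T z)) = state_class (state z)" if "z \<in> Y" for z
    by (rule equiv_class_eq[OF equiv_q, symmetric])
      (use state_skew_map_in_state_class that Y in blast)
  then have "?T ` Z \<subseteq> Z" using inv unfolding Z_def by blast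
  moreover have "y \<in> Z" "Z \<subseteq> Y" using y by (auto simp: Z_def)
  ultimately have "Z = Y" using minimal_closed_invariant_eqI[OF min] by blast
  then have "z \<in> Z" using z by simp
  then show ?thesis by (simp add: Z_def)
qed

lemma minimal_cylinder_averages:
  assumes min: "minimal_closed_invariant (skew_topology G (shift_space \<tau>)) (skew_map G \<phi>) Y"
    and C: "C \<in> cylinders Y"
  shows "\<exists>c. \<forall>y\<in>Y. (\<lambda>N. birkhoff_average (skew_map G \<phi>) (indicator C) N y) \<longlonglongrightarrow> c"
proof -
  let ?T = "skew_map G \<phi>"
  note inv = minimal_skewD(1)[OF min] and Y = minimal_skewD(4)[OF min]
  obtain y0 where y0: "y0 \<in> Y" using minimal_skewD(3)[OF min] by blast
  interpret positive_substitution "lift_substitution ^^ q" "state_class (state y0)"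
    using y0 Y by (intro positive_substitution_class) (auto simp: state_def)
  obtain n L P where code: "\<And>y. y \<in> Y \<Longrightarrow> (?T ^^ n) y \<in> C \<longleftrightarrow> itinerary state ?T y L \<in> P"
    using cylinder_coded_by_itinerary[OF inv C] by blast
  have "quasi_additive (2 * real L) (block_sum L (indicat_real P))"
    by (rule quasi_additive_block_sum) (simp add: indicator_def)
  then obtain c where c: "((\<lambda>w. block_sum L (indicator P) w / length w) \<longlongrightarrow> c) (long_words language)"
    using uniform_frequency by blast
  have "(\<lambda>N. birkhoff_average ?T (indicator C) N y) \<longlonglongrightarrow> c" if y: "y \<in> Y" for y
  proof (rule birkhoff_average_tendsto_frequency[OF _ _ c])
    show "(?T ^^ n) ((?T ^^ i) y) \<in> C \<longleftrightarrow> itinerary state ?T ((?T ^^ i) y) L \<in> P" for i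
      using code funpow_mem[OF inv y] by blast
    have "y \<in> carrier G \<times> shift_space \<tau>" using y Y by blast
    then show "itinerary state ?T y N \<in> language" for N
      using itinerary_in_class_language minimal_state_class[OF min y0 y] by metis
  qed
  then show ?thesis by blast
qed

theorem minimal_uniquely_ergodic:
  assumes min: "minimal_closed_invariant (skew_topology G (shift_space \<tau>)) (skew_map G \<phi>) Y"
  shows "uniquely_ergodic (skew_topology G (shift_space \<tau>)) (skew_map G \<phi>) Y"
proof -
  let ?\<T> = "skew_topology G (shift_space \<tau>)" and ?T = "skew_map G \<phi>"
  note inv = minimal_skewD(1)[OF min] and closed = minimal_skewD(2)[OF min]
    and Y = minimal_skewD(4)[OF min]
  show ?thesis
  proof (rule uniquely_ergodicI)
    have "compact_space ?\<T>"
      using finite_carrier closedin_shift_space by (rule compact_space_skew_topology)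
    then show "compact_space (subtopology ?\<T> Y)"
      using closed closedin_compact_space compact_space_subtopology by blast
    show "Sigma_Algebra.algebra Y (cylinders Y)" by (rule algebra_cylinders)
    show "sets (borel_measurable_space (subtopology ?\<T> Y)) = sigma_sets Y (cylinders Y)"
      using Y by (rule sets_borel_skew_subtopology)
    show "closedin (subtopology ?\<T> Y) C" if "C \<in> cylinders Y" for C
      using Y that by (rule closedin_cylinder)
    show "?T -` C \<inter> Y \<in> cylinders Y" if "C \<in> cylinders Y" for C
      using inv that by (rule cylinder_vimage_skew_map)
    show "\<exists>c. \<forall>y\<in>Y. (\<lambda>N. birkhoff_average ?T (indicator C) N y) \<longlonglongrightarrow> c" if "C \<in> cylinders Y" for C
      using min that by (rule minimal_cylinder_averages)
  qed (rule inv minimal_skewD(3)[OF min])+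
qed

end

section \<open>Primitive invertible substitutions\<close>

lemma invertible_primitive_positive_power:
  assumes "substitution \<sigma>" "primitive \<sigma>" "invertible_under \<phi> \<sigma>"
  obtains n where "n \<ge> 1" "letter_positive (\<sigma> ^^ n)" "\<phi> \<circ> (\<sigma> ^^ n) = \<phi>"
proof -
  obtain m where m: "m \<ge> 1" "letter_positive (\<sigma> ^^ m)"
    using assms(2) by (auto simp: primitive_iff_letter_positive)
  obtain p where p: "p \<ge> 1" "\<phi> \<circ> (\<sigma> ^^ p) = \<phi>"
    using assms(3) by (auto simp: invertible_under_def)
  have "\<phi> \<circ> ((\<sigma> ^^ p) ^^ k) = \<phi>" for k
  proof (induction k)
    case (Suc k)
    then show ?case using p(2) by (simp add: fun_eq_iff)
  qed simp
  moreover have "letter_positive ((\<sigma> ^^ m) ^^ p)"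
    using substitution_funpow[OF assms(1)] m(2) p(1) by (rule letter_positive_funpow)
  ultimately show thesis
    using m(1) p(1) by (intro that[of "m * p"]) (simp_all add: funpow_mult mult.commute)
qed

theorem proposition8p3:
  fixes \<sigma> :: "'a::finite list \<Rightarrow> 'a list"
    and G :: "('g, 'k) monoid_scheme"
    and \<phi> :: "'a list \<Rightarrow> 'g"
  assumes "substitution \<sigma>"
    and "primitive \<sigma>"
    and "shift_space \<sigma> \<noteq> {}"
    and "group G"
    and "finite (carrier G)"
    and "monoid_morphism free_monoid G \<phi>"
    and "range \<phi> = carrier G"
    and "invertible_under \<phi> \<sigma>"
  shows "\<forall>Y. minimal_closed_invariant (skew_topology G (shift_space \<sigma>)) (skew_map G \<phi>) Y \<longrightarrow>
             uniquely_ergodic (skew_topology G (shift_space \<sigma>)) (skew_map G \<phi>) Y"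
proof -
  obtain n where n: "n \<ge> 1" "letter_positive (\<sigma> ^^ n)" "\<phi> \<circ> (\<sigma> ^^ n) = \<phi>"
    using assms(1,2,8) by (rule invertible_primitive_positive_power)
  have shift: "shift_space (\<sigma> ^^ n) = shift_space \<sigma>"
    using assms(1,2) n(1) by (rule shift_space_funpow)
  interpret group G by fact
  interpret skew_substitution G \<phi> "\<sigma> ^^ n"
    using assms n by unfold_locales (simp_all add: substitution_funpow)
  obtain q where q: "q \<ge> 1" "equiv (carrier G \<times> UNIV) (state_graph q)"
    using ex_equiv_state_graph[OF assms(5) _ n(2)] by auto
  interpret equiv_skew_substitution G \<phi> "\<sigma> ^^ n" q
    using assms n q shift by unfold_locales simp_all
  show ?thesis using minimal_uniquely_ergodic unfolding shift by blast
qed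

end
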